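(* Let $d\ge 2$, $r\ge 1$, $\varepsilon>0$, and let $f:\mathbb{R}^d\to\mathbb{R}^d$ be a $C^r$-diffeomorphism. Let $M\subset\mathbb{R}^d$ be a compact set with $C^r$-smooth boundary $\partial M$. Then $M$ is invariant for the set-valued map $F_{f,\varepsilon}$ if and only if its outer unit normal bundle $N_1^+\partial M$ is invariant for the boundary map $\beta_{f,\varepsilon}$; that is, $$F_{f,\varepsilon}(M)=M \iff \beta_{f,\varepsilon}(N_1^+\partial M)=N_1^+\partial M.$$
   Context: For $x\in\mathbb{R}^d$ let $F_{f,\varepsilon}(x)=\overline{B_\varepsilon(f(x))}=\{y\in\mathbb{R}^d:\|y-f(x)\|\le\varepsilon\}$ (Euclidean norm), and for $A\subset\mathbb{R}^d$ let $F_{f,\varepsilon}(A)=\bigcup_{x\in A}F_{f,\varepsilon}(x)$. The unit tangent bundle is $T_1\mathbb{R}^d=\mathbb{R}^d\times S^{d-1}$. The boundary map $\beta_{f,\varepsilon}:T_1\mathbb{R}^d\to T_1\mathbb{R}^d$ is $$\beta_{f,\varepsilon}(x,n)=\left(f(x)+\varepsilon\frac{f'(x)^{-T}n}{\|f'(x)^{-T}n\|},\ \frac{f'(x)^{-T}n}{\|f'(x)^{-T}n\|}\right),$$ where $f'(x)^{-T}$ is the inverse transpose of the Jacobian matrix $f'(x)$. That $M$ has $C^r$-smooth boundary means that $\partial M$ is a compact embedded hypersurface (codimension-one submanifold without boundary) of class $C^r$ bounding $M$. The outer unit normal bundle is $N_1^+\partial M=\{(x,n): x\in\partial M,\ n \text{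 is the unit normal vector to } \partial M \text{ at } x \text{ pointing outward from } M\}\subset T_1\mathbb{R}^d$. *)

theory Defs
  imports "HOL-Analysis.Analysis"
begin

(* C^k regularity on an open set S: all iterated directional derivatives up to order k
   exist (as values of Frechet derivatives) and are continuous. Only meaningful for open S,
   because the derivative is taken at x and not within S. *)
fun Ck_on :: "nat \<Rightarrow> ('a::real_normed_vector \<Rightarrow> 'b::real_normed_vector) \<Rightarrow> 'a set \<Rightarrow> bool" where
  "Ck_on 0 f S \<longleftrightarrow> continuous_on S f"
| "Ck_on (Suc k) f S \<longleftrightarrow>
     (\<forall>x\<in>S. f differentiable (at x)) \<and>
     (\<forall>v. Ck_on k (\<lambda>x. frechet_derivative f (at x) v) S)"

definition Ck_diffeo :: "nat \<Rightarrow> ('a::real_normed_vector) set \<Rightarrow> ('b::real_normed_vector) set \<Rightarrow> ('a \<Rightarrow> 'b) \<Rightarrow> bool" where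
  "Ck_diffeo r U V \<phi> \<longleftrightarrow>
     open U \<and> open V \<and> Ck_on r \<phi> U \<and>
     (\<exists>\<psi>. homeomorphism U V \<phi> \<psi> \<and> Ck_on r \<psi> V)"

definition F_map :: "(real^'n \<Rightarrow> real^'n) \<Rightarrow> real \<Rightarrow> real^'n \<Rightarrow> (real^'n) set" where
  "F_map f \<epsilon> x = cball (f x) \<epsilon>"

definition F_image :: "(real^'n \<Rightarrow> real^'n) \<Rightarrow> real \<Rightarrow> (real^'n) set \<Rightarrow> (real^'n) set" where
  "F_image f \<epsilon> A = (\<Union>x\<in>A. F_map f \<epsilon> x)"

definition unit_tangent_bundle :: "((real^'n) \<times> (real^'n)) set" where
  "unit_tangent_bundle = UNIV \<times> sphere 0 1"

(* The boundary map as a total function on pairs; it is of interest on the unit tangent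
   bundle only, and jacobian is the Jacobian matrix of the Frechet derivative. *)
definition boundary_map ::
  "(real^'n \<Rightarrow> real^'n) \<Rightarrow> real \<Rightarrow> (real^'n) \<times> (real^'n) \<Rightarrow> (real^'n) \<times> (real^'n)" where
  "boundary_map f \<epsilon> = (\<lambda>(x, n).
     let w = matrix_inv (transpose (jacobian f (at x))) *v n
     in (f x + \<epsilon> *\<^sub>R (w /\<^sub>R norm w), w /\<^sub>R norm w))"

(* Embedded codimension-one submanifold without boundary, by slice charts of the ambient
   space. The empty set qualifies. *)
definition embedded_hypersurface :: "nat \<Rightarrow> (real^'n) set \<Rightarrow> bool" where
  "embedded_hypersurface r S \<longleftrightarrow>
     (\<forall>p\<in>S. \<exists>U (V :: (real^'n) set) \<phi> i.
        p \<in> U \<and> Ck_diffeo r U V \<phi> \<and> \<phi> ` (S \<inter> U) = {y \<in> V. y $ i = 0})"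

(* The condition M = closure (interior M) says that the hypersurface bounds M: near each
   boundary point exactly one of the two local sides of the hypersurface belongs to M. It
   excludes, for instance, M being the hypersurface itself. *)
definition smooth_boundary :: "nat \<Rightarrow> (real^'n) set \<Rightarrow> bool" where
  "smooth_boundary r M \<longleftrightarrow>
     compact (frontier M) \<and> embedded_hypersurface r (frontier M) \<and> M = closure (interior M)"

(* Velocities at x of curves in S through x. *)
definition tangent_vectors :: "(real^'n) set \<Rightarrow> real^'n \<Rightarrow> (real^'n) set" where
  "tangent_vectors S x =
     {v. \<exists>\<gamma> :: real \<Rightarrow> real^'n. \<exists>\<delta>>0. Ck_on 1 \<gamma> {-\<delta><..<\<delta>} \<and>
           \<gamma> ` {-\<delta><..<\<delta>} \<subseteq> S \<and> \<gamma> 0 = x \<and> (\<gamma> has_vector_derivative v) (at 0)}"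

definition outer_unit_normal_bundle :: "(real^'n) set \<Rightarrow> ((real^'n) \<times> (real^'n)) set" where
  "outer_unit_normal_bundle M =
     {(x, n) \<in> unit_tangent_bundle.
        x \<in> frontier M \<and>
        (\<forall>v \<in> tangent_vectors (frontier M) x. n \<bullet> v = 0) \<and>
        (\<exists>\<delta>>0. \<forall>t. 0 < t \<and> t < \<delta> \<longrightarrow> x + t *\<^sub>R n \<notin> M)}"

end

theory Submission
  imports Defs
begin

text \<open>Write \<open>K = f ` M\<close>. Then \<^term>\<open>F_image f \<epsilon> M\<close> is the closed \<open>\<epsilon>\<close>-neighbourhood of \<open>K\<close>, and the inverse
transpose in the boundary map carries the outer unit normals of \<open>M\<close> to those of \<open>K\<close>. Hence
invariance of the normal bundle says that \<open>(y, n) \<mapsto> (y + \<epsilon> n, n)\<close> maps the normal bundle of \<open>K\<close>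
onto that of \<open>M\<close> (lemma \<open>boundary_map_invariant_iff\<close>), and the theorem compares the
neighbourhood of \<open>K\<close> with this shift of its normals.

Suppose that the neighbourhood is \<open>M\<close>. A boundary point \<open>x\<close> of \<open>M\<close> has distance \<open>\<epsilon>\<close> from \<open>K\<close>; the
ball about a nearest point \<open>y\<close> touches \<open>\<partial>M\<close> from inside and the ball about \<open>x\<close> touches \<open>\<partial>K\<close> from
outside, so both normals equal \<open>(x - y) / \<epsilon>\<close> and \<open>y = x - \<epsilon> n\<close>. The shift thus hits all normals of
\<open>M\<close>. That nothing of \<open>\<partial>K\<close> is left over is global: \<open>x \<mapsto> f\<^sup>-\<^sup>1(x - \<epsilon> n)\<close> is an injective
continuous map of the compact hypersurface \<open>\<partial>M\<close> into itself. By invariance of domain it sends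
components onto components, and as there are finitely many, it is onto
(\<open>thicken_eq_imp_normal_shift\<close>).

Conversely, suppose that the shift matches the normals. Nearest points show that the boundary of the
neighbourhood is contained in \<open>\<partial>M\<close>, from which \<open>M\<close> lies in the neighbourhood, and the
neighbourhood arises from \<open>M\<close> by filling some holes, that is, bounded components of the complement.
The danger is a hole that is filled. Iterating \<open>F\<close> on \<open>M\<close> and taking the union gives \<open>A \<supseteq> M\<close> with
\<open>F A = A\<close>, again \<open>M\<close> with some holes filled, so the first direction applies to \<open>A\<close>. Removing the
normals of \<open>A\<close> from those of \<open>M\<close> leaves the boundary of the filled part \<open>P\<close>, the closure of
\<open>A - M\<close>, on which the normals point into \<open>P\<close>. Reversing them turns the hypothesis for \<open>(f, M)\<close>
into the same hypothesis for \<open>(f\<^sup>-\<^sup>1, f ` P)\<close>, whose boundary has fewer components. By induction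
\<open>f ` P\<close> is the closed \<open>\<epsilon>\<close>-neighbourhood of \<open>P\<close>; hence \<open>K\<close>, which meets \<open>f ` P\<close> in boundary
points only, stays too far from \<open>A - M\<close> to reach it, and no hole was filled
(\<open>normal_shift_imp_thicken_eq\<close>).

Smoothness of \<open>\<partial>M\<close> enters this argument through two consequences: at each boundary point there is a
unit normal in the first-order sense of \<open>unit_normal\<close>, and near it \<open>M\<close> looks topologically like a
half space (\<open>half_space_chart\<close>). Both survive diffeomorphisms, filling of holes and passing to
the filled part, which is what makes the induction possible.\<close>

section \<open>First-order outer unit normals\<close>

text \<open>Outer unit normals are taken in a pointwise, first-order sense: near \<open>x\<close>, the open cones of
directions around \<open>n\<close> and \<open>- n\<close>, of any aperture below the half space, lie outside \<open>M\<close> and in its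
interior, respectively. This determines \<open>n\<close>, and using the interior makes the condition symmetric under
exchange of the two sides of a closed set.\<close>

definition unit_normal :: "'a::euclidean_space set \<Rightarrow> 'a \<Rightarrow> 'a \<Rightarrow> bool" where
  "unit_normal M x n \<longleftrightarrow> norm n = 1 \<and>
     (\<forall>c>0. \<forall>\<^sub>F z in at x.
        (c * norm (z - x) < (z - x) \<bullet> n \<longrightarrow> z \<notin> M) \<and>
        ((z - x) \<bullet> n < - c * norm (z - x) \<longrightarrow> z \<in> interior M))"

text \<open>A curve whose velocity is not tangential runs into one of the two cones at once. Rays give the touching
ball arguments; general curves give orthogonality of \<open>n\<close> to tangent vectors.\<close>

lemma unit_normal_along_curve:
  fixes \<gamma> :: "real \<Rightarrow> 'a::euclidean_space"
  assumes N: "unit_normal M x n"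
    and \<gamma>: "(\<gamma> has_vector_derivative w) (at_right 0)" "\<gamma> 0 = x"
  shows "w \<bullet> n > 0 \<Longrightarrow> \<forall>\<^sub>F t in at_right 0. \<gamma> t \<notin> M"
    and "w \<bullet> n < 0 \<Longrightarrow> \<forall>\<^sub>F t in at_right 0. \<gamma> t \<in> interior M"
proof -
  have lim: "((\<lambda>t. (\<gamma> t - x) /\<^sub>R t) \<longlongrightarrow> w) (at_right 0)"
  proof -
    have "((\<lambda>t. (1 / norm (t - 0)) *\<^sub>R (\<gamma> t - (\<gamma> 0 + (t - 0) *\<^sub>R w))) \<longlongrightarrow> 0) (at_right 0)"
      using \<gamma>(1) unfolding has_vector_derivative_def has_derivative_within by blast
    moreover have "\<forall>\<^sub>F t in at_right 0. (1 / norm (t - 0)) *\<^sub>R (\<gamma> t - (\<gamma> 0 + (t - 0) *\<^sub>R w))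
        = (\<gamma> t - x) /\<^sub>R t - w"
      unfolding eventually_at_right_field
      by (intro exI[of _ 1]) (auto simp: \<gamma>(2) algebra_simps divide_simps)
    ultimately have "((\<lambda>t. (\<gamma> t - x) /\<^sub>R t - w) \<longlongrightarrow> 0) (at_right 0)"
      by (simp add: tendsto_cong)
    then show ?thesis
      by (simp add: LIM_zero_iff)
  qed
  have cont: "(\<gamma> \<longlongrightarrow> x) (at_right 0)"
    using has_vector_derivative_continuous[OF \<gamma>(1)] \<gamma>(2)
    by (simp add: continuous_within)
  have pos: "\<forall>\<^sub>F t in at_right (0::real). 0 < t"
    by (simp add: eventually_at_right_less)
  \<comment> \<open>Half of the slope of the curve along the normal is enough to enter the cone; the added 1
      keeps the denominator positive. The sign s treats both sides at once.\<close>
  have main: "\<forall>\<^sub>F t in at_right 0. 0 < t \<and> \<gamma> t \<noteq> x \<and> c * norm (\<gamma> t - x) < (\<gamma> t - x) \<bullet> (s *\<^sub>R n)"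
    if s: "w \<bullet> (s *\<^sub>R n) > 0" and c: "c = (w \<bullet> (s *\<^sub>R n)) / (2 * (norm w + 1))" for s c
  proof -
    have c0: "c > 0" using s unfolding c by (simp add: add_nonneg_pos)
    have "c * norm w < w \<bullet> (s *\<^sub>R n)"
    proof -
      define b where "b = norm w + 1"
      have "b > 0" by (simp add: b_def add_nonneg_pos)
      then have "c * (norm w + 1) = (w \<bullet> (s *\<^sub>R n)) / 2"
        unfolding c b_def[symmetric] by simp
      with s have "c * (norm w + 1) < w \<bullet> (s *\<^sub>R n)" by simp
      then show ?thesis using c0 by (simp add: algebra_simps)
    qed
    moreover have "((\<lambda>t. ((\<gamma> t - x) /\<^sub>R t) \<bullet> (s *\<^sub>R n) - c * norm ((\<gamma> t - x) /\<^sub>R t))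
        \<longlongrightarrow> w \<bullet> (s *\<^sub>R n) - c * norm w) (at_right 0)"
      by (intro tendsto_intros lim)
    ultimately have "\<forall>\<^sub>F t in at_right 0. 0 < ((\<gamma> t - x) /\<^sub>R t) \<bullet> (s *\<^sub>R n) - c * norm ((\<gamma> t - x) /\<^sub>R t)"
      by (intro order_tendstoD(1)[where y = "w \<bullet> (s *\<^sub>R n) - c * norm w"]) auto
    with pos show ?thesis
    proof eventually_elim
      case (elim t)
      have "((\<gamma> t - x) /\<^sub>R t) \<bullet> (s *\<^sub>R n) - c * norm ((\<gamma> t - x) /\<^sub>R t)
          = ((\<gamma> t - x) \<bullet> (s *\<^sub>R n) - c * norm (\<gamma> t - x)) / t"
        using elim(1) by (simp only: inner_scaleR_left norm_scaleR) (simp add: field_simps)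
      with elim show ?case by (auto simp: zero_less_divide_iff)
    qed
  qed
  have at: "filterlim \<gamma> (at x) (at_right 0)" if "\<forall>\<^sub>F t in at_right 0. \<gamma> t \<noteq> x"
    using that cont by (simp add: filterlim_at)
  show "\<forall>\<^sub>F t in at_right 0. \<gamma> t \<notin> M" if w: "w \<bullet> n > 0"
  proof -
    define c where "c = (w \<bullet> (1 *\<^sub>R n)) / (2 * (norm w + 1))"
    have m: "\<forall>\<^sub>F t in at_right 0. 0 < t \<and> \<gamma> t \<noteq> x \<and> c * norm (\<gamma> t - x) < (\<gamma> t - x) \<bullet> (1 *\<^sub>R n)"
      by (rule main) (use w c_def in auto)
    have "c > 0" using w by (simp add: c_def add_nonneg_pos)
    then have "\<forall>\<^sub>F z in at x. c * norm (z - x) < (z - x) \<bullet> n \<longrightarrow> z \<notin> M"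
      using N unfolding unit_normal_def by (auto elim!: allE[of _ c] eventually_mono)
    moreover have "filterlim \<gamma> (at x) (at_right 0)"
      by (rule at) (use m in \<open>auto elim: eventually_mono\<close>)
    ultimately have "\<forall>\<^sub>F t in at_right 0. c * norm (\<gamma> t - x) < (\<gamma> t - x) \<bullet> n \<longrightarrow> \<gamma> t \<notin> M"
      by (rule eventually_compose_filterlim)
    with m show ?thesis by eventually_elim simp
  qed
  show "\<forall>\<^sub>F t in at_right 0. \<gamma> t \<in> interior M" if w: "w \<bullet> n < 0"
  proof -
    define c where "c = (w \<bullet> ((-1) *\<^sub>R n)) / (2 * (norm w + 1))"
    have m: "\<forall>\<^sub>F t in at_right 0. 0 < t \<and> \<gamma> t \<noteq> x \<and> c * norm (\<gamma> t - x) < (\<gamma> t - x) \<bullet> ((-1) *\<^sub>R n)"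
      by (rule main) (use w c_def in auto)
    have "c > 0" using w by (simp add: c_def add_nonneg_pos divide_neg_pos)
    then have "\<forall>\<^sub>F z in at x. (z - x) \<bullet> n < - c * norm (z - x) \<longrightarrow> z \<in> interior M"
      using N unfolding unit_normal_def by (auto elim!: allE[of _ c] eventually_mono)
    moreover have "filterlim \<gamma> (at x) (at_right 0)"
      by (rule at) (use m in \<open>auto elim: eventually_mono\<close>)
    ultimately have "\<forall>\<^sub>F t in at_right 0. (\<gamma> t - x) \<bullet> n < - c * norm (\<gamma> t - x) \<longrightarrow> \<gamma> t \<in> interior M"
      by (rule eventually_compose_filterlim)
    with m show ?thesis by eventually_elim simp
  qed
qed

lemma unit_normal_along_ray:
  assumes "unit_normal M x n"
  shows "w \<bullet> n > 0 \<Longrightarrow> \<forall>\<^sub>F t in at_right 0. x + t *\<^sub>R w \<notin> M"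
    and "w \<bullet> n < 0 \<Longrightarrow> \<forall>\<^sub>F t in at_right 0. x + t *\<^sub>R w \<in> interior M"
proof -
  have "((\<lambda>t. x + t *\<^sub>R w) has_vector_derivative w) (at_right 0)"
    by (auto intro!: derivative_eq_intros)
  from unit_normal_along_curve[OF assms this]
  show "w \<bullet> n > 0 \<Longrightarrow> \<forall>\<^sub>F t in at_right 0. x + t *\<^sub>R w \<notin> M"
    and "w \<bullet> n < 0 \<Longrightarrow> \<forall>\<^sub>F t in at_right 0. x + t *\<^sub>R w \<in> interior M"
    by simp_all
qed

lemma tendsto_ray: "((\<lambda>t. x + t *\<^sub>R w) \<longlongrightarrow> (x::'a::real_normed_vector)) (at_right 0)"
  by (auto intro!: tendsto_eq_intros)

lemma unit_normal_norm: "unit_normal M x n \<Longrightarrow> norm n = 1"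
  by (simp add: unit_normal_def)

lemma unit_normal_self: "unit_normal M x n \<Longrightarrow> n \<bullet> n = 1"
  by (simp add: unit_normal_norm norm_eq_1[symmetric])

lemma unit_normal_in_frontier:
  assumes "unit_normal M x n"
  shows "x \<in> frontier M"
proof -
  have trv: "\<not> trivial_limit (at_right (0::real))" by simp
  have i: "\<forall>\<^sub>F t in at_right 0. x + t *\<^sub>R (- n) \<in> interior M"
    by (rule unit_normal_along_ray(2)[OF assms]) (simp add: unit_normal_self[OF assms])
  have o: "\<forall>\<^sub>F t in at_right 0. x + t *\<^sub>R n \<notin> M"
    by (rule unit_normal_along_ray(1)[OF assms]) (simp add: unit_normal_self[OF assms])
  have "x \<in> closure (interior M)"
    by (rule Lim_in_closed_set[OF _ _ trv tendsto_ray[of x "- n"]])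
       (use i closure_subset[of "interior M"] in \<open>auto elim!: eventually_mono\<close>)
  moreover have "x \<in> closure (- M)"
    by (rule Lim_in_closed_set[OF _ _ trv tendsto_ray[of x n]])
       (use o closure_subset[of "- M"] in \<open>auto elim!: eventually_mono\<close>)
  ultimately show "x \<in> frontier M"
    using closure_mono[OF interior_subset] by (auto simp: frontier_closures)
qed

text \<open>A direction that points outward for one candidate normal and inward for the other: a ray along it
refutes two different candidates at once.\<close>

lemma unit_vectors_separated:
  fixes m n :: "'a::euclidean_space"
  assumes "norm m = 1" "norm n = 1" "m \<noteq> n"
  shows "(m - n) \<bullet> m > 0" "(m - n) \<bullet> n < 0"
proof -
  have "(norm (m - n))\<^sup>2 = 2 - 2 * (m \<bullet> n)"
    using assms by (simp add: power2_norm_eq_inner inner_diff inner_commute norm_eq_1)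
  moreover have "(norm (m - n))\<^sup>2 > 0" using assms by simp
  ultimately have "m \<bullet> n < 1" by linarith
  then show "(m - n) \<bullet> m > 0" "(m - n) \<bullet> n < 0"
    using assms by (simp_all add: inner_diff norm_eq_1 inner_commute)
qed

lemma unit_normal_unique:
  assumes "unit_normal M x m" "unit_normal M x n"
  shows "m = n"
proof (rule ccontr)
  assume "m \<noteq> n"
  note s = unit_vectors_separated[OF unit_normal_norm[OF assms(1)] unit_normal_norm[OF assms(2)] this]
  have "\<forall>\<^sub>F t in at_right 0. x + t *\<^sub>R (m - n) \<notin> M \<and> x + t *\<^sub>R (m - n) \<in> interior M"
    using unit_normal_along_ray(1)[OF assms(1) s(1)] unit_normal_along_ray(2)[OF assms(2) s(2)]
    by eventually_elim simp
  then have "\<forall>\<^sub>F t in at_right (0::real). False"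
    by eventually_elim (use interior_subset in blast)
  then show False by simp
qed

lemma ray_enters_ball:
  fixes c x w :: "'a::euclidean_space"
  assumes "norm (x - c) = e" "w \<bullet> (x - c) < 0"
  shows "\<forall>\<^sub>F t in at_right 0. x + t *\<^sub>R w \<in> ball c e"
proof -
  have "((\<lambda>t. 2 * (w \<bullet> (x - c)) + t * (norm w)\<^sup>2) \<longlongrightarrow> 2 * (w \<bullet> (x - c)) + 0 * (norm w)\<^sup>2) (at_right 0)"
    by (intro tendsto_intros)
  then have "\<forall>\<^sub>F t in at_right 0. 2 * (w \<bullet> (x - c)) + t * (norm w)\<^sup>2 < 0"
    by (rule order_tendstoD(2)) (use assms in simp)
  moreover have "\<forall>\<^sub>F t in at_right (0::real). 0 < t"
    by (simp add: eventually_at_right_less)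
  ultimately show ?thesis
  proof eventually_elim
    case (elim t)
    have "(norm (x + t *\<^sub>R w - c))\<^sup>2 = (norm (x - c))\<^sup>2 + t * (2 * (w \<bullet> (x - c)) + t * (norm w)\<^sup>2)"
    proof -
      have "x + t *\<^sub>R w - c = (x - c) + t *\<^sub>R w" by simp
      then show ?thesis
        by (simp only: power2_norm_eq_inner inner_add inner_scaleR_left inner_scaleR_right inner_commute[of "x - c" w])
           (simp add: algebra_simps)
    qed
    also have "\<dots> < (norm (x - c))\<^sup>2"
      using elim by (simp add: mult_pos_neg)
    finally have "norm (x + t *\<^sub>R w - c) < norm (x - c)"
      using power2_less_imp_less norm_ge_zero by blast
    then show ?case using assms by (simp add: dist_norm norm_minus_commute)
  qed
qed

text \<open>A ball in \<open>M\<close> touching the boundary at \<open>x\<close> has there the same tangent half space as \<open>M\<close>, for otherwise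
some ray from \<open>x\<close> would enter the ball and leave \<open>M\<close>.\<close>

lemma unit_normal_inner_ball:
  assumes N: "unit_normal M x n" and b: "ball c e \<subseteq> M" and e: "norm (x - c) = e" "e > 0"
  shows "x = c + e *\<^sub>R n"
proof (rule ccontr)
  define m where "m = (x - c) /\<^sub>R e"
  have m1: "norm m = 1" using e by (simp add: m_def)
  have xm: "x - c = e *\<^sub>R m" using e by (simp add: m_def)
  assume "\<not> ?thesis"
  then have "n \<noteq> m" using xm by (auto simp: algebra_simps)
  note s = unit_vectors_separated[OF unit_normal_norm[OF N] m1 this]
  have "(n - m) \<bullet> (x - c) < 0" using s(2) e by (simp add: xm mult_pos_neg)
  from ray_enters_ball[OF e(1) this] unit_normal_along_ray(1)[OF N s(1)]
  have "\<forall>\<^sub>F t in at_right (0::real). False"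
    by eventually_elim (use b in blast)
  then show False by simp
qed

lemma unit_normal_outer_ball:
  assumes N: "unit_normal M x n" and b: "ball c e \<inter> M = {}" and e: "norm (c - x) = e" "e > 0"
  shows "c = x + e *\<^sub>R n"
proof (rule ccontr)
  define m where "m = (c - x) /\<^sub>R e"
  have m1: "norm m = 1" using e by (simp add: m_def)
  have xm: "c - x = e *\<^sub>R m" using e by (simp add: m_def)
  assume "\<not> ?thesis"
  then have "m \<noteq> n" using xm by (auto simp: algebra_simps)
  note s = unit_vectors_separated[OF m1 unit_normal_norm[OF N] this]
  have "x - c = - e *\<^sub>R m" using xm by (metis minus_diff_eq scaleR_left.minus)
  then have "(m - n) \<bullet> (x - c) < 0" using s(1) e by simp
  moreover have "norm (x - c) = e" using e by (simp add: norm_minus_commute)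
  ultimately have "\<forall>\<^sub>F t in at_right 0. x + t *\<^sub>R (m - n) \<in> ball c e"
    by (rule ray_enters_ball[rotated])
  with unit_normal_along_ray(2)[OF N s(2)]
  have "\<forall>\<^sub>F t in at_right (0::real). False"
    by eventually_elim (use b interior_subset in blast)
  then show False by simp
qed

lemma unit_normal_cong:
  assumes "open U" "x \<in> U" "\<forall>z\<in>U. z \<in> M \<longleftrightarrow> z \<in> A" "unit_normal M x n"
  shows "unit_normal A x n"
proof -
  have int: "z \<in> interior A" if "z \<in> U" "z \<in> interior M" for z
  proof -
    have "U \<inter> interior M \<subseteq> interior A"
      by (rule interior_maximal) (use assms interior_subset in blast)+
    with that show ?thesis by blast
  qed
  have U: "\<forall>\<^sub>F z in at x. z \<in> U"
    using assms(1,2) by (rule eventually_at_in_open')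
  show ?thesis
    unfolding unit_normal_def
  proof (intro conjI allI impI)
    show "norm n = 1" using assms(4) by (rule unit_normal_norm)
    fix c :: real assume "c > 0"
    with assms(4) have "\<forall>\<^sub>F z in at x.
        (c * norm (z - x) < (z - x) \<bullet> n \<longrightarrow> z \<notin> M) \<and>
        ((z - x) \<bullet> n < - c * norm (z - x) \<longrightarrow> z \<in> interior M)"
      unfolding unit_normal_def by blast
    with U show "\<forall>\<^sub>F z in at x.
        (c * norm (z - x) < (z - x) \<bullet> n \<longrightarrow> z \<notin> A) \<and>
        ((z - x) \<bullet> n < - c * norm (z - x) \<longrightarrow> z \<in> interior A)"
      by eventually_elim (use assms(3) int in blast)
  qed
qed

section \<open>Diffeomorphisms and normals\<close>

text \<open>The inverse is carried along and the condition is symmetric, because the induction passes from a map to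
its inverse. Invertibility of the derivatives follows from the chain rule.\<close>

definition diffeo_pair :: "('a::euclidean_space \<Rightarrow> 'a) \<Rightarrow> ('a \<Rightarrow> 'a) \<Rightarrow> bool" where
  "diffeo_pair f g \<longleftrightarrow> (\<forall>x. g (f x) = x) \<and> (\<forall>y. f (g y) = y) \<and>
     (\<forall>x. f differentiable at x) \<and> (\<forall>y. g differentiable at y)"

lemma diffeo_pair_sym: "diffeo_pair f g \<Longrightarrow> diffeo_pair g f"
  by (auto simp: diffeo_pair_def)

lemma diffeo_pair_continuous: "diffeo_pair f g \<Longrightarrow> continuous_on S f"
  by (auto simp: diffeo_pair_def intro!: continuous_at_imp_continuous_on differentiable_imp_continuous_within)

lemma diffeo_pair_homeomorphism: "diffeo_pair f g \<Longrightarrow> homeomorphism S (f ` S) f g"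
  by (rule homeomorphismI) (auto simp: diffeo_pair_def intro: diffeo_pair_continuous diffeo_pair_sym)

lemma diffeo_pair_image_iff: "diffeo_pair f g \<Longrightarrow> y \<in> f ` S \<longleftrightarrow> g y \<in> S"
  unfolding diffeo_pair_def by (metis image_iff)

lemma diffeo_pair_image_eq_vimage: "diffeo_pair f g \<Longrightarrow> f ` S = g -` S"
  using diffeo_pair_image_iff by blast

lemma diffeo_pair_open: "diffeo_pair f g \<Longrightarrow> open S \<Longrightarrow> open (f ` S)"
proof -
  assume d: "diffeo_pair f g" "open S"
  then show ?thesis
    using open_vimage[OF d(2)] diffeo_pair_continuous[OF diffeo_pair_sym[OF d(1)]]
    by (metis diffeo_pair_image_eq_vimage)
qed

lemma diffeo_pair_interior:
  assumes "diffeo_pair f g"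
  shows "interior (f ` S) = f ` interior S"
proof
  show "f ` interior S \<subseteq> interior (f ` S)"
    by (intro interior_maximal image_mono interior_subset diffeo_pair_open[OF assms]) simp
  have "g ` interior (f ` S) \<subseteq> interior S"
    by (rule interior_maximal)
       (use interior_subset[of "f ` S"] in
         \<open>auto intro!: diffeo_pair_open[OF diffeo_pair_sym[OF assms]]
           simp: diffeo_pair_image_eq_vimage[OF assms]\<close>)
  then show "interior (f ` S) \<subseteq> f ` interior S"
    unfolding diffeo_pair_image_eq_vimage[OF assms] by blast
qed

lemma diffeo_pair_closure:
  assumes "diffeo_pair f g"
  shows "closure (f ` S) = f ` closure S"
proof -
  have compl: "f ` (- T) = - (f ` T)" for T
    unfolding diffeo_pair_image_eq_vimage[OF assms] by auto
  show ?thesis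
    unfolding closure_interior using diffeo_pair_interior[OF assms, of "- S"] compl by metis
qed

lemma diffeo_pair_frontier:
  assumes "diffeo_pair f g"
  shows "frontier (f ` S) = f ` frontier S"
  unfolding frontier_def diffeo_pair_closure[OF assms] diffeo_pair_interior[OF assms]
  unfolding diffeo_pair_image_eq_vimage[OF assms] by auto

text \<open>The hypothesis on \<open>m\<close> says that the transpose of the derivative sends \<open>m\<close> to \<open>n\<close>, so \<open>m\<close> is the
inverse transpose applied to \<open>n\<close>. Pulling a point \<open>z\<close> near \<open>f x\<close> back by \<open>g\<close> changes its height along
the normal only by the factor \<open>norm m\<close> and a first-order error, so that cones are pulled back into
cones.\<close>

lemma unit_normal_diffeo_image:
  assumes d: "diffeo_pair f g" and N: "unit_normal M x n"
    and f': "(f has_derivative f') (at x)" and m: "\<And>w. m \<bullet> f' w = n \<bullet> w"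
  shows "unit_normal (f ` M) (f x) (sgn m)"
proof -
  have gf[simp]: "g (f y) = y" and fg[simp]: "f (g y) = y" for y using d by (auto simp: diffeo_pair_def)
  obtain g' where g': "(g has_derivative g') (at (f x))"
    using d unfolding diffeo_pair_def differentiable_def by blast
  have "m \<noteq> 0"
  proof
    assume "m = 0"
    then have "n \<bullet> n = 0" using m[of n] by simp
    then show False using unit_normal_self[OF N] by simp
  qed
  have f'g': "f' (g' w) = w" for w
  proof -
    have "(f has_derivative f') (at (g (f x)))" using f' by simp
    from diff_chain_at[OF g' this] have "((\<lambda>y. y) has_derivative f' \<circ> g') (at (f x))"
      by (simp add: comp_def)
    from has_derivative_unique[OF this has_derivative_ident] show ?thesis by (simp add: fun_eq_iff)
  qed
  have mw: "n \<bullet> g' w = m \<bullet> w" for w using m[of "g' w"] f'g' by simp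
  have bl: "bounded_linear g'" using g' by (rule has_derivative_bounded_linear)
  have lim: "filterlim g (at x) (at (f x))"
  proof -
    have "(g \<longlongrightarrow> x) (at (f x))"
      using has_derivative_continuous[OF g'] by (simp add: continuous_within)
    moreover have "\<forall>\<^sub>F z in at (f x). g z \<noteq> x"
      unfolding eventually_at_filter by (rule always_eventually) (metis fg)
    ultimately show ?thesis by (simp add: filterlim_at)
  qed
  show ?thesis
    unfolding unit_normal_def
  proof (intro conjI allI impI)
    show "norm (sgn m) = 1" using \<open>m \<noteq> 0\<close> by (simp add: norm_sgn)
    fix c :: real assume c: "c > 0"
    \<comment> \<open>One half of the margin c * norm m is spent on the error of the linear approximation, the
        other half remains; B bounds the local stretching by g and converts lengths at f x into
        lengths at x.\<close>
    define e where "e = c * norm m / 2"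
    define B where "B = onorm g' + e"
    define c' where "c' = e / B"
    have e: "e > 0" using c \<open>m \<noteq> 0\<close> by (simp add: e_def)
    have B: "B > 0" using e onorm_pos_le[OF bl] by (simp add: B_def)
    have c': "c' > 0" using e B by (simp add: c'_def)
    have "\<forall>\<^sub>F z in at (f x). norm (g z - g (f x) - g' (z - f x)) \<le> e * norm (z - f x)"
      using g' e unfolding has_derivative_within_alt2 by blast
    moreover have "\<forall>\<^sub>F z in at x.
        (c' * norm (z - x) < (z - x) \<bullet> n \<longrightarrow> z \<notin> M) \<and>
        ((z - x) \<bullet> n < - c' * norm (z - x) \<longrightarrow> z \<in> interior M)"
      using N c' unfolding unit_normal_def by blast
    then have "\<forall>\<^sub>F z in at (f x).
        (c' * norm (g z - x) < (g z - x) \<bullet> n \<longrightarrow> g z \<notin> M) \<and>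
        ((g z - x) \<bullet> n < - c' * norm (g z - x) \<longrightarrow> g z \<in> interior M)"
      using lim by (rule eventually_compose_filterlim)
    ultimately show "\<forall>\<^sub>F z in at (f x).
        (c * norm (z - f x) < (z - f x) \<bullet> sgn m \<longrightarrow> z \<notin> f ` M) \<and>
        ((z - f x) \<bullet> sgn m < - c * norm (z - f x) \<longrightarrow> z \<in> interior (f ` M))"
    proof eventually_elim
      case (elim z)
      define r where "r = g z - x - g' (z - f x)"
      define D where "D = norm (z - f x)"
      have r: "norm r \<le> e * D" using elim(1) by (simp add: r_def D_def)
      have "norm (g z - x) \<le> norm (g' (z - f x)) + norm r"
        unfolding r_def by (smt (verit) norm_triangle_sub)
      also have "\<dots> \<le> B * D"
        using onorm[OF bl, of "z - f x"] r by (simp add: B_def D_def distrib_right)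
      finally have gz: "c' * norm (g z - x) \<le> e * D"
        using B e by (simp add: c'_def divide_simps mult.commute mult.left_commute)
      have inner: "(g z - x) \<bullet> n = (z - f x) \<bullet> m + r \<bullet> n"
        using mw[of "z - f x"] by (simp add: r_def inner_diff inner_commute)
      have rn: "\<bar>r \<bullet> n\<bar> \<le> e * D"
        using Cauchy_Schwarz_ineq2[of r n] r unit_normal_norm[OF N] by simp
      have sg: "(z - f x) \<bullet> m = norm m * ((z - f x) \<bullet> sgn m)"
        using \<open>m \<noteq> 0\<close> by (simp add: sgn_div_norm)
      have "c' * norm (g z - x) < (g z - x) \<bullet> n" if "c * D < (z - f x) \<bullet> sgn m"
      proof -
        have "2 * e * D < (z - f x) \<bullet> m"
          using mult_strict_left_mono[OF that, of "norm m"] \<open>m \<noteq> 0\<close> by (simp add: sg e_def mult_ac)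
        then show ?thesis using gz inner rn by linarith
      qed
      moreover have "(g z - x) \<bullet> n < - c' * norm (g z - x)" if "(z - f x) \<bullet> sgn m < - c * D"
      proof -
        have "(z - f x) \<bullet> m < - (2 * e * D)"
          using mult_strict_left_mono[OF that, of "norm m"] \<open>m \<noteq> 0\<close> by (simp add: sg e_def mult_ac)
        then show ?thesis using gz inner rn by linarith
      qed
      ultimately show ?case
        using elim(2) diffeo_pair_image_iff[OF d]
        unfolding D_def diffeo_pair_interior[OF d] by blast
    qed
  qed
qed

lemma unit_normal_diffeo_image_ex:
  assumes d: "diffeo_pair f g" and N: "unit_normal M x n"
  shows "\<exists>m. unit_normal (f ` M) (f x) m"
proof -
  obtain f' where f': "(f has_derivative f') (at x)"
    using d unfolding diffeo_pair_def differentiable_def by blast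
  obtain g' where g': "(g has_derivative g') (at (f x))"
    using d unfolding diffeo_pair_def differentiable_def by blast
  from diff_chain_at[OF f' g'] have "((\<lambda>y. y) has_derivative g' \<circ> f') (at x)"
    using d by (simp add: comp_def diffeo_pair_def)
  from has_derivative_unique[OF this has_derivative_ident]
  have "g' (f' w) = w" for w by (simp add: fun_eq_iff)
  moreover have "linear g'" using g' by (simp add: has_derivative_linear)
  ultimately have "adjoint g' n \<bullet> f' w = n \<bullet> w" for w
    by (simp add: adjoint_clauses)
  from unit_normal_diffeo_image[OF d N f' this] show ?thesis by blast
qed

section \<open>Domains that are locally half spaces\<close>

text \<open>A topological chart in which \<open>M\<close> becomes a closed half space. The half space is given by a covector \<open>a\<close>
rather than by a coordinate, so that exchanging the sides just means replacing \<open>a\<close> by \<open>- a\<close>. The chart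
fills a ball, which makes both open sides and the hypersurface between them connected.\<close>

definition half_space_chart ::
  "'a::euclidean_space set \<Rightarrow> 'a \<Rightarrow> 'a set \<Rightarrow> ('a \<Rightarrow> 'a) \<Rightarrow> ('a \<Rightarrow> 'a) \<Rightarrow> real \<Rightarrow> 'a \<Rightarrow> bool" where
  "half_space_chart M x U \<phi> \<psi> r a \<longleftrightarrow> open U \<and> x \<in> U \<and> 0 < r \<and>
     homeomorphism U (ball (\<phi> x) r) \<phi> \<psi> \<and> a \<noteq> 0 \<and> a \<bullet> \<phi> x = 0 \<and>
     (\<forall>z\<in>U. z \<in> M \<longleftrightarrow> a \<bullet> \<phi> z \<le> 0)"

text \<open>Points at height 0 are not interior, since moving along \<open>a\<close> in the chart leaves \<open>M\<close>; the other
positions are open conditions.\<close>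

lemma half_space_chart_position:
  assumes C: "half_space_chart M x U \<phi> \<psi> r a" and z: "z \<in> U"
  shows "z \<in> interior M \<longleftrightarrow> a \<bullet> \<phi> z < 0" "z \<in> frontier M \<longleftrightarrow> a \<bullet> \<phi> z = 0"
proof -
  have U: "open U" and hom: "homeomorphism U (ball (\<phi> x) r) \<phi> \<psi>" and a: "a \<noteq> 0"
    and M: "\<And>z. z \<in> U \<Longrightarrow> z \<in> M \<longleftrightarrow> a \<bullet> \<phi> z \<le> 0"
    using C by (auto simp: half_space_chart_def)
  have cont: "continuous_on U \<phi>" and contp: "continuous_on (ball (\<phi> x) r) \<psi>"
    using hom by (auto simp: homeomorphism_def)
  have 1: "a \<bullet> \<phi> z < 0 \<Longrightarrow> z \<in> interior M"
  proof -
    assume "a \<bullet> \<phi> z < 0"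
    have "open (U \<inter> (\<lambda>z. a \<bullet> \<phi> z) -` {..<0})"
      by (intro continuous_open_preimage continuous_intros cont U open_lessThan)
    then have "U \<inter> (\<lambda>z. a \<bullet> \<phi> z) -` {..<0} \<subseteq> interior M"
      by (intro interior_maximal) (auto simp: M)
    with z \<open>a \<bullet> \<phi> z < 0\<close> show ?thesis by auto
  qed
  have 2: "a \<bullet> \<phi> z = 0 \<Longrightarrow> z \<notin> interior M"
  proof
    assume az: "a \<bullet> \<phi> z = 0" and i: "z \<in> interior M"
    have b: "\<phi> z \<in> ball (\<phi> x) r" using hom z by (auto simp: homeomorphism_def)
    have "isCont \<psi> (\<phi> z)" using contp b by (simp add: continuous_on_eq_continuous_at)
    then have "((\<lambda>t. \<psi> (\<phi> z + t *\<^sub>R a)) \<longlongrightarrow> \<psi> (\<phi> z)) (at_right 0)"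
      by (rule isCont_tendsto_compose) (rule tendsto_ray)
    moreover have "\<psi> (\<phi> z) = z" using hom z by (auto simp: homeomorphism_def)
    ultimately have "\<forall>\<^sub>F t in at_right 0. \<psi> (\<phi> z + t *\<^sub>R a) \<in> interior M"
      using i topological_tendstoD[of _ z _ "interior M"] by simp
    moreover have "\<forall>\<^sub>F t in at_right 0. \<phi> z + t *\<^sub>R a \<in> ball (\<phi> x) r"
      by (rule topological_tendstoD[OF tendsto_ray open_ball b])
    moreover have "\<forall>\<^sub>F t in at_right (0::real). 0 < t"
      by (simp add: eventually_at_right_less)
    ultimately have "\<forall>\<^sub>F t in at_right (0::real). False"
    proof eventually_elim
      case (elim t)
      have "\<psi> (\<phi> z + t *\<^sub>R a) \<in> U" "\<phi> (\<psi> (\<phi> z + t *\<^sub>R a)) = \<phi> z + t *\<^sub>R a"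
        using elim(2) hom by (auto simp: homeomorphism_def)
      moreover have "\<psi> (\<phi> z + t *\<^sub>R a) \<in> M" using elim(1) interior_subset by blast
      ultimately have "a \<bullet> (\<phi> z + t *\<^sub>R a) \<le> 0" using M by metis
      moreover have "a \<bullet> (\<phi> z + t *\<^sub>R a) = t * (a \<bullet> a)" using az by (simp add: inner_add)
      moreover have "t * (a \<bullet> a) > 0" using a elim(3) by simp
      ultimately show False by linarith
    qed
    then show False by simp
  qed
  have 3: "a \<bullet> \<phi> z > 0 \<Longrightarrow> z \<notin> closure M"
  proof -
    assume "a \<bullet> \<phi> z > 0"
    have "open (U \<inter> (\<lambda>z. a \<bullet> \<phi> z) -` {0<..})"
      by (intro continuous_open_preimage continuous_intros cont U open_greaterThan)
    moreover have "(U \<inter> (\<lambda>z. a \<bullet> \<phi> z) -` {0<..}) \<inter> M = {}" by (auto simp: M)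
    ultimately have "(U \<inter> (\<lambda>z. a \<bullet> \<phi> z) -` {0<..}) \<inter> closure M = {}"
      using open_Int_closure_eq_empty by blast
    with z \<open>a \<bullet> \<phi> z > 0\<close> show ?thesis by auto
  qed
  have 4: "z \<in> interior M \<Longrightarrow> a \<bullet> \<phi> z \<le> 0" "a \<bullet> \<phi> z = 0 \<Longrightarrow> z \<in> closure M"
    using M[OF z] interior_subset[of M] closure_subset[of M] by auto
  show "z \<in> interior M \<longleftrightarrow> a \<bullet> \<phi> z < 0" using 1 2 4 by force
  show "z \<in> frontier M \<longleftrightarrow> a \<bullet> \<phi> z = 0"
    unfolding frontier_def using 1 2 3 4 by force
qed

lemma half_space_chart_connected:
  assumes C: "half_space_chart M x U \<phi> \<psi> r a"
  shows "connected (U - M)" "connected (U \<inter> interior M)" "connected (U \<inter> frontier M)"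
proof -
  have hom: "homeomorphism U (ball (\<phi> x) r) \<phi> \<psi>"
    and M: "\<And>z. z \<in> U \<Longrightarrow> z \<in> M \<longleftrightarrow> a \<bullet> \<phi> z \<le> 0"
    using C by (auto simp: half_space_chart_def)
  have conn: "connected {z \<in> U. \<phi> z \<in> H}" if "convex H" for H
  proof -
    have "{z \<in> U. \<phi> z \<in> H} = \<psi> ` (ball (\<phi> x) r \<inter> H)"
      using hom unfolding homeomorphism_def by (auto simp: image_iff)
    moreover have "connected (\<psi> ` (ball (\<phi> x) r \<inter> H))"
      using hom that
      by (intro connected_continuous_image convex_connected convex_Int)
         (auto simp: homeomorphism_def intro: continuous_on_subset)
    ultimately show ?thesis by simp
  qed
  have "U - M = {z \<in> U. \<phi> z \<in> {y. a \<bullet> y > 0}}" using M by force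
  then show "connected (U - M)" using conn[OF convex_halfspace_gt] by metis
  have "U \<inter> interior M = {z \<in> U. \<phi> z \<in> {y. a \<bullet> y < 0}}"
    using half_space_chart_position(1)[OF C] by auto
  then show "connected (U \<inter> interior M)" using conn[OF convex_halfspace_lt] by metis
  have "U \<inter> frontier M = {z \<in> U. \<phi> z \<in> {y. a \<bullet> y = 0}}"
    using half_space_chart_position(2)[OF C] by auto
  then show "connected (U \<inter> frontier M)" using conn[OF convex_hyperplane] by metis
qed

text \<open>The two consequences of a smooth boundary that carry the global argument, one of first order and one
topological. The class is closed under the three constructions of the induction: images under
diffeomorphisms, filling holes, and passing to the closure of the filled part.\<close>

definition regular_domain :: "'a::euclidean_space set \<Rightarrow> bool" where
  "regular_domain M \<longleftrightarrow> compact M \<and>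
     (\<forall>x\<in>frontier M. (\<exists>n. unit_normal M x n) \<and> (\<exists>U \<phi> \<psi> r a. half_space_chart M x U \<phi> \<psi> r a))"

lemma regular_domain_closed: "regular_domain M \<Longrightarrow> closed M"
  by (simp add: regular_domain_def compact_imp_closed)

lemma regular_domain_frontier_subset: "regular_domain M \<Longrightarrow> frontier M \<subseteq> M"
  by (simp add: regular_domain_closed frontier_subset_closed)

lemma regular_domain_normal: "regular_domain M \<Longrightarrow> x \<in> frontier M \<Longrightarrow> \<exists>n. unit_normal M x n"
  by (simp add: regular_domain_def)

lemma regular_domain_chart:
  assumes "regular_domain M" "x \<in> frontier M"
  obtains U \<phi> \<psi> r a where "half_space_chart M x U \<phi> \<psi> r a" "open U" "x \<in> U"
  using assms unfolding regular_domain_def half_space_chart_def by metis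

lemma half_space_chart_diffeo_image:
  assumes d: "diffeo_pair f g" and C: "half_space_chart M x U \<phi> \<psi> r a"
  shows "half_space_chart (f ` M) (f x) (f ` U) (\<phi> \<circ> g) (f \<circ> \<psi>) r a"
proof -
  have gf: "g (f y) = y" for y using d by (simp add: diffeo_pair_def)
  have "homeomorphism U (ball (\<phi> x) r) \<phi> \<psi>" using C by (simp add: half_space_chart_def)
  then have "homeomorphism (f ` U) (ball (\<phi> x) r) (\<phi> \<circ> g) (f \<circ> \<psi>)"
    using homeomorphism_compose homeomorphism_symD[OF diffeo_pair_homeomorphism[OF d]] by blast
  then show ?thesis
    using C diffeo_pair_open[OF d] unfolding half_space_chart_def
    by (auto simp: gf diffeo_pair_image_iff[OF d])
qed

lemma regular_domain_diffeo_image: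
  assumes d: "diffeo_pair f g" and M: "regular_domain M"
  shows "regular_domain (f ` M)"
proof -
  have "compact (f ` M)"
    using M diffeo_pair_continuous[OF d] by (simp add: regular_domain_def compact_continuous_image)
  then show ?thesis
    unfolding regular_domain_def diffeo_pair_frontier[OF d]
    using unit_normal_diffeo_image_ex[OF d] half_space_chart_diffeo_image[OF d] M
    unfolding regular_domain_def by blast
qed

section \<open>Filling holes\<close>

text \<open>A compact set \<open>A \<supseteq> M\<close> whose boundary lies in that of \<open>M\<close> is, for closed \<open>M\<close>, the set \<open>M\<close> together
with some components of its complement: a component of the complement of \<open>M\<close> avoids the boundary of \<open>A\<close>, hence lies in \<open>A\<close> or
misses it. The condition on the boundary is the form of this that passes to thickenings and unions.\<close>

definition hole_filling :: "'a::euclidean_space set \<Rightarrow> 'a set \<Rightarrow> bool" where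
  "hole_filling M A \<longleftrightarrow> M \<subseteq> A \<and> compact A \<and> frontier A \<subseteq> frontier M"

lemma hole_filling_diffeo_image:
  "diffeo_pair f g \<Longrightarrow> hole_filling M A \<Longrightarrow> hole_filling (f ` M) (f ` A)"
  by (auto simp: hole_filling_def diffeo_pair_frontier intro!: compact_continuous_image diffeo_pair_continuous)

text \<open>At a boundary point of \<open>A\<close> the local outer side of \<open>M\<close> is connected and not contained in \<open>A\<close>, so it
misses \<open>A\<close>. Thus \<open>A\<close> inherits charts and normals from \<open>M\<close>.\<close>

lemma hole_filling_chart_agrees:
  assumes M: "regular_domain M" and A: "hole_filling M A"
    and C: "half_space_chart M x U \<phi> \<psi> r a" and x: "x \<in> frontier A"
  shows "\<forall>z\<in>U. z \<in> M \<longleftrightarrow> z \<in> A"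
proof -
  have U: "open U" "x \<in> U" using C by (auto simp: half_space_chart_def)
  have "x \<in> closure (- A)" using x by (simp add: frontier_closures)
  then have "U \<inter> - A \<noteq> {}"
    using U open_Int_closure_eq_empty by blast
  then have "(U - M) - A \<noteq> {}" using A by (auto simp: hole_filling_def)
  moreover have "(U - M) \<inter> frontier A = {}"
    using A regular_domain_frontier_subset[OF M] by (auto simp: hole_filling_def)
  ultimately have "(U - M) \<inter> A = {}"
    using connected_Int_frontier half_space_chart_connected(1)[OF C] by blast
  then show ?thesis using A by (auto simp: hole_filling_def)
qed

lemma hole_filling_normal_iff:
  assumes M: "regular_domain M" and A: "hole_filling M A"
  shows "unit_normal A x n \<longleftrightarrow> unit_normal M x n \<and> x \<in> frontier A"
proof -
  { assume x: "x \<in> frontier A"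
    then have "x \<in> frontier M" using A by (auto simp: hole_filling_def)
    then obtain U \<phi> \<psi> r a where C: "half_space_chart M x U \<phi> \<psi> r a" "open U" "x \<in> U"
      using regular_domain_chart[OF M] by metis
    have "\<forall>z\<in>U. z \<in> M \<longleftrightarrow> z \<in> A" by (rule hole_filling_chart_agrees[OF M A C(1) x])
    then have "unit_normal A x n \<longleftrightarrow> unit_normal M x n"
      using unit_normal_cong[OF C(2,3)] by metis }
  then show ?thesis using unit_normal_in_frontier by blast
qed

lemma hole_filling_regular:
  assumes M: "regular_domain M" and A: "hole_filling M A"
  shows "regular_domain A"
  unfolding regular_domain_def
proof (intro conjI ballI)
  show "compact A" using A by (simp add: hole_filling_def)
  fix x assume x: "x \<in> frontier A"
  then have xM: "x \<in> frontier M" using A by (auto simp: hole_filling_def)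
  then show "\<exists>n. unit_normal A x n"
    using regular_domain_normal[OF M] hole_filling_normal_iff[OF M A] x by blast
  obtain U \<phi> \<psi> r a where C: "half_space_chart M x U \<phi> \<psi> r a"
    using regular_domain_chart[OF M xM] by metis
  from hole_filling_chart_agrees[OF M A C x] C
  have "half_space_chart A x U \<phi> \<psi> r a" by (auto simp: half_space_chart_def)
  then show "\<exists>U \<phi> \<psi> r a. half_space_chart A x U \<phi> \<psi> r a" by blast
qed

lemma hole_filling_diff_open:
  assumes M: "regular_domain M" and A: "hole_filling M A"
  shows "open (A - M)"
proof -
  have "A - M = interior A - M"
    using A regular_domain_frontier_subset[OF M] compact_imp_closed[of A] interior_subset[of A]
    by (auto simp: hole_filling_def frontier_def)
  then show ?thesis using regular_domain_closed[OF M] by (simp add: open_Diff)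
qed

text \<open>The opposite alternative to the preceding agreement: at the remaining boundary points of \<open>M\<close> the whole
local outer side has been filled.\<close>

lemma filled_hole_chart_subset:
  assumes M: "regular_domain M" and A: "hole_filling M A"
    and C: "half_space_chart M x U \<phi> \<psi> r a" and x: "x \<in> frontier M" "x \<notin> frontier A"
  shows "U - M \<subseteq> A"
proof -
  have U: "open U" "x \<in> U" using C by (auto simp: half_space_chart_def)
  have "x \<in> A" using x A regular_domain_frontier_subset[OF M] by (auto simp: hole_filling_def)
  then have "x \<in> interior A" using x A closure_subset[of A] by (auto simp: frontier_def)
  moreover have "x \<in> closure (- M)" using x by (simp add: frontier_closures)
  ultimately have "(U \<inter> interior A) \<inter> - M \<noteq> {}"
    using U open_Int_closure_eq_empty[of "U \<inter> interior A" "- M"] by blast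
  then have "(U - M) \<inter> A \<noteq> {}" using interior_subset by blast
  moreover have "(U - M) \<inter> frontier A = {}"
    using A regular_domain_frontier_subset[OF M] by (auto simp: hole_filling_def)
  ultimately show ?thesis
    using connected_Int_frontier half_space_chart_connected(1)[OF C] by blast
qed

text \<open>The filled part lies on the other side of the same hypersurface, so its charts have the opposite covector
and, further below, its normals have the opposite sign.\<close>

lemma filled_hole_chart:
  assumes M: "regular_domain M" and A: "hole_filling M A"
    and C: "half_space_chart M x U \<phi> \<psi> r a" and x: "x \<in> frontier M" "x \<notin> frontier A"
  shows "half_space_chart (closure (A - M)) x U \<phi> \<psi> r (- a)"
proof -
  have U: "open U" and iff: "\<And>z. z \<in> U \<Longrightarrow> z \<in> M \<longleftrightarrow> a \<bullet> \<phi> z \<le> 0"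
    using C by (auto simp: half_space_chart_def)
  note UM = filled_hole_chart_subset[OF assms]
  have "z \<in> closure (A - M) \<longleftrightarrow> a \<bullet> \<phi> z \<ge> 0" if z: "z \<in> U" for z
  proof (cases "a \<bullet> \<phi> z < 0")
    case True
    then have "z \<in> interior M" using half_space_chart_position(1)[OF C z] by simp
    moreover have "interior M \<inter> (A - M) = {}" using interior_subset by blast
    ultimately have "z \<notin> closure (A - M)"
      using open_Int_closure_eq_empty[OF open_interior] by blast
    then show ?thesis using True by simp
  next
    case False
    then have "z \<in> closure (- M)"
      using iff[OF z] half_space_chart_position(2)[OF C z] closure_subset[of "- M"]
      by (cases "a \<bullet> \<phi> z = 0") (auto simp: frontier_closures)
    then have "z \<in> closure (U \<inter> - M)"
      using open_Int_closure_subset[OF U] z by blast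
    also have "\<dots> \<subseteq> closure (A - M)" by (rule closure_mono) (use UM in blast)
    finally show ?thesis using False by simp
  qed
  then show ?thesis using C by (auto simp: half_space_chart_def)
qed

lemma filled_hole_closure:
  assumes M: "regular_domain M" and A: "hole_filling M A"
  shows "closure (A - M) = (A - M) \<union> (frontier M - frontier A)"
proof
  show "closure (A - M) \<subseteq> (A - M) \<union> (frontier M - frontier A)"
  proof
    fix x assume x: "x \<in> closure (A - M)"
    have "closed A" using A by (simp add: hole_filling_def compact_imp_closed)
    then have xA: "x \<in> A" using x closure_minimal[of "A - M" A] by auto
    have "interior M \<inter> (A - M) = {}" using interior_subset by blast
    then have "x \<notin> interior M"
      using x open_Int_closure_eq_empty[OF open_interior] by blast
    moreover have "x \<notin> frontier A" if xM: "x \<in> frontier M"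
    proof
      assume xfA: "x \<in> frontier A"
      obtain U \<phi> \<psi> r a where C: "half_space_chart M x U \<phi> \<psi> r a" "open U" "x \<in> U"
        using regular_domain_chart[OF M xM] by metis
      have "U \<inter> (A - M) = {}" using hole_filling_chart_agrees[OF M A C(1) xfA] by blast
      then show False using C x open_Int_closure_eq_empty by blast
    qed
    ultimately show "x \<in> (A - M) \<union> (frontier M - frontier A)"
      using xA closure_subset[of M] by (auto simp: frontier_def)
  qed
  show "(A - M) \<union> (frontier M - frontier A) \<subseteq> closure (A - M)"
  proof (intro Un_least closure_subset subsetI)
    fix x assume x: "x \<in> frontier M - frontier A"
    then obtain U \<phi> \<psi> r a where C: "half_space_chart M x U \<phi> \<psi> r a"
      using regular_domain_chart[OF M] by (metis DiffD1)
    have "half_space_chart (closure (A - M)) x U \<phi> \<psi> r (- a)"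
      by (rule filled_hole_chart[OF M A C]) (use x in auto)
    then show "x \<in> closure (A - M)"
      unfolding half_space_chart_def by simp
  qed
qed

lemma filled_hole_frontier:
  assumes M: "regular_domain M" and A: "hole_filling M A"
  shows "frontier (closure (A - M)) = frontier M - frontier A"
proof
  have "A - M \<subseteq> interior (closure (A - M))"
    by (rule interior_maximal[OF closure_subset hole_filling_diff_open[OF M A]])
  moreover have "frontier (closure (A - M)) = closure (A - M) - interior (closure (A - M))"
    by (simp add: frontier_def)
  ultimately show "frontier (closure (A - M)) \<subseteq> frontier M - frontier A"
    using filled_hole_closure[OF M A] by blast
  show "frontier M - frontier A \<subseteq> frontier (closure (A - M))"
  proof
    fix x assume x: "x \<in> frontier M - frontier A"
    then obtain U \<phi> \<psi> r a where C: "half_space_chart M x U \<phi> \<psi> r a"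
      using regular_domain_chart[OF M] by (metis DiffD1)
    have C': "half_space_chart (closure (A - M)) x U \<phi> \<psi> r (- a)"
      by (rule filled_hole_chart[OF M A C]) (use x in auto)
    then have "x \<in> U" "(- a) \<bullet> \<phi> x = 0" by (auto simp: half_space_chart_def)
    then show "x \<in> frontier (closure (A - M))"
      using half_space_chart_position(2)[OF C'] by simp
  qed
qed

lemma filled_hole_normal:
  assumes M: "regular_domain M" and A: "hole_filling M A"
    and x: "x \<notin> frontier A" and N: "unit_normal M x n"
  shows "unit_normal (closure (A - M)) x (- n)"
proof -
  have xM: "x \<in> frontier M" by (rule unit_normal_in_frontier[OF N])
  obtain U \<phi> \<psi> r a where C: "half_space_chart M x U \<phi> \<psi> r a" "open U" "x \<in> U"
    using regular_domain_chart[OF M xM] by metis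
  have UM: "U - M \<subseteq> interior (closure (A - M))"
    using filled_hole_chart_subset[OF M A C(1) xM x]
      interior_maximal[OF closure_subset hole_filling_diff_open[OF M A]] by blast
  have "interior M \<inter> (A - M) = {}" using interior_subset by blast
  then have iM: "interior M \<inter> closure (A - M) = {}"
    using open_Int_closure_eq_empty[OF open_interior] by blast
  have evU: "\<forall>\<^sub>F z in at x. z \<in> U" using C(2,3) by (rule eventually_at_in_open')
  show ?thesis
    unfolding unit_normal_def
  proof (intro conjI allI impI)
    show "norm (- n) = 1" using unit_normal_norm[OF N] by simp
    fix c :: real assume "c > 0"
    with N have "\<forall>\<^sub>F z in at x.
        (c * norm (z - x) < (z - x) \<bullet> n \<longrightarrow> z \<notin> M) \<and>
        ((z - x) \<bullet> n < - c * norm (z - x) \<longrightarrow> z \<in> interior M)"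
      unfolding unit_normal_def by blast
    with evU show "\<forall>\<^sub>F z in at x.
        (c * norm (z - x) < (z - x) \<bullet> (- n) \<longrightarrow> z \<notin> closure (A - M)) \<and>
        ((z - x) \<bullet> (- n) < - c * norm (z - x) \<longrightarrow> z \<in> interior (closure (A - M)))"
    proof eventually_elim
      case (elim z)
      then show ?case using iM UM by auto
    qed
  qed
qed

lemma filled_hole_normal_iff:
  assumes M: "regular_domain M" and A: "hole_filling M A"
  shows "unit_normal (closure (A - M)) x n \<longleftrightarrow> unit_normal M x (- n) \<and> x \<notin> frontier A"
proof
  assume N: "unit_normal (closure (A - M)) x n"
  from unit_normal_in_frontier[OF this]
  have x: "x \<in> frontier M" "x \<notin> frontier A" by (auto simp: filled_hole_frontier[OF M A])
  then obtain m where m: "unit_normal M x m" using regular_domain_normal[OF M] by blast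
  have "n = - m" by (rule unit_normal_unique[OF N filled_hole_normal[OF M A x(2) m]])
  with m x show "unit_normal M x (- n) \<and> x \<notin> frontier A" by simp
next
  assume "unit_normal M x (- n) \<and> x \<notin> frontier A"
  then show "unit_normal (closure (A - M)) x n"
    using filled_hole_normal[OF M A, of x "- n"] by simp
qed

lemma filled_hole_regular:
  assumes M: "regular_domain M" and A: "hole_filling M A"
  shows "regular_domain (closure (A - M))"
  unfolding regular_domain_def filled_hole_frontier[OF M A]
proof (intro conjI ballI)
  have "bounded (A - M)"
    using A by (auto simp: hole_filling_def dest: compact_imp_bounded intro: bounded_subset)
  then show "compact (closure (A - M))" by (simp add: compact_closure)
  fix x assume x: "x \<in> frontier M - frontier A"
  then show "\<exists>n. unit_normal (closure (A - M)) x n"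
    using filled_hole_normal[OF M A] regular_domain_normal[OF M] by blast
  obtain U \<phi> \<psi> r a where C: "half_space_chart M x U \<phi> \<psi> r a"
    using regular_domain_chart[OF M] x by (metis DiffD1)
  have "half_space_chart (closure (A - M)) x U \<phi> \<psi> r (- a)"
    by (rule filled_hole_chart[OF M A C]) (use x in auto)
  then show "\<exists>U \<phi> \<psi> r a. half_space_chart (closure (A - M)) x U \<phi> \<psi> r a" by blast
qed

section \<open>Components of the boundary hypersurface\<close>

lemma component_diffeo_image:
  assumes d: "diffeo_pair f g" and C: "C \<in> components S"
  shows "f ` C \<in> components (f ` S)"
proof -
  have d': "diffeo_pair g f" by (rule diffeo_pair_sym[OF d])
  have fg: "f ` g ` D = D" "g ` f ` D = D" for D
    using d by (simp_all add: diffeo_pair_def image_image)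
  have C': "C \<noteq> {}" "C \<subseteq> S" "connected C"
    and max: "\<And>D. D \<noteq> {} \<Longrightarrow> C \<subseteq> D \<Longrightarrow> D \<subseteq> S \<Longrightarrow> connected D \<Longrightarrow> D = C"
    using C unfolding in_components_maximal by auto
  show ?thesis
    unfolding in_components_maximal
  proof (intro conjI allI impI)
    show "connected (f ` C)"
      by (intro connected_continuous_image diffeo_pair_continuous[OF d] C')
    show "f ` C \<noteq> {}" "f ` C \<subseteq> f ` S" using C' by auto
    fix D assume D: "D \<noteq> {} \<and> f ` C \<subseteq> D \<and> D \<subseteq> f ` S \<and> connected D"
    have "g ` D = C"
    proof (rule max)
      show "connected (g ` D)"
        using D by (intro connected_continuous_image diffeo_pair_continuous[OF d']) auto
      show "g ` D \<noteq> {}" using D by auto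
      show "C \<subseteq> g ` D" "g ` D \<subseteq> S" using D fg(2) by (metis image_mono)+
    qed
    then show "D = f ` C" using fg(1) by metis
  qed
qed

lemma card_components_diffeo_image:
  assumes d: "diffeo_pair f g"
  shows "card (components (f ` S)) = card (components S)"
proof -
  have d': "diffeo_pair g f" by (rule diffeo_pair_sym[OF d])
  have fg: "f ` g ` D = D" "g ` f ` D = D" for D
    using d by (simp_all add: diffeo_pair_def image_image)
  have "bij_betw ((`) f) (components S) (components (f ` S))"
    by (rule bij_betwI[where g = "(`) g"])
       (use component_diffeo_image[OF d] component_diffeo_image[OF d', of _ "f ` S"] fg in auto)
  then show ?thesis by (simp add: bij_betw_same_card)
qed

text \<open>This makes the induction of the converse direction terminate: the boundary of the filled part is a closed
piece of \<open>\<partial>M\<close> whose complement in \<open>\<partial>M\<close> is closed and nonempty.\<close>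

lemma card_components_clopen_part:
  fixes X :: "'a::topological_space set"
  assumes fin: "finite (components X)" and X: "X = S \<union> T" "S \<inter> T = {}" "closed S" "closed T" "T \<noteq> {}"
  shows "card (components S) < card (components X)"
proof (rule psubset_card_mono[OF fin])
  have sub: "C \<in> components X" if C: "C \<in> components S" for C
    unfolding in_components_maximal
  proof (intro conjI allI impI)
    have C': "C \<noteq> {}" "C \<subseteq> S" "connected C"
      and max: "\<And>D. D \<noteq> {} \<Longrightarrow> C \<subseteq> D \<Longrightarrow> D \<subseteq> S \<Longrightarrow> connected D \<Longrightarrow> D = C"
      using C unfolding in_components_maximal by auto
    show "C \<noteq> {}" "connected C" "C \<subseteq> X" using C' X(1) by auto
    fix D assume D: "D \<noteq> {} \<and> C \<subseteq> D \<and> D \<subseteq> X \<and> connected D"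
    then have "S \<inter> D = {} \<or> T \<inter> D = {}"
      using X connected_closedD[of D S T] by auto
    then have "D \<subseteq> S" using D C' X(1) by auto
    then show "D = C" using max D by blast
  qed
  obtain t where t: "t \<in> T" using X by auto
  then obtain C where C: "C \<in> components X" "t \<in> C"
    using Union_components[of X] X(1) by (metis UnCI UnionE)
  have "C \<notin> components S" using in_components_subset C(2) t X(2) by blast
  then show "components S \<subset> components X" using sub C by blast
qed

lemma finite_components_if_open:
  fixes X :: "'a::metric_space set"
  assumes "compact X" and op: "\<And>C. C \<in> components X \<Longrightarrow> openin (top_of_set X) C"
  shows "finite (components X)"
proof -
  obtain D where D: "D \<subseteq> components X" "finite D" "X \<subseteq> \<Union>D"
    using assms Union_components[of X] unfolding compact_eq_openin_cover by (metis order_refl)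
  have "components X \<subseteq> D"
  proof
    fix C assume C: "C \<in> components X"
    then obtain x where x: "x \<in> C" using in_components_nonempty by blast
    then obtain C' where C': "C' \<in> D" "x \<in> C'" using D(3) in_components_subset[OF C] by blast
    then have "C = C'" using components_nonoverlap[OF C, of C'] D(1) x by blast
    with C' show "C \<in> D" by simp
  qed
  then show ?thesis using D finite_subset by blast
qed

text \<open>The image of a component is connected, open and, by compactness, closed, hence again a component.
Distinct components have distinct images, and an injective map of a finite set into itself is onto.\<close>

lemma injective_open_self_map_surj:
  fixes X :: "'a::euclidean_space set"
  assumes X: "compact X" and op: "\<And>C. C \<in> components X \<Longrightarrow> openin (top_of_set X) C"
    and g: "continuous_on X g" "g ` X \<subseteq> X" "inj_on g X"
    and gop: "\<And>C. openin (top_of_set X) C \<Longrightarrow> openin (top_of_set X) (g ` C)"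
  shows "g ` X = X"
proof -
  have im: "g ` C \<in> components X" if C: "C \<in> components X" for C
  proof -
    have CX: "C \<subseteq> X" "C \<noteq> {}" by (rule in_components_subset[OF C], rule in_components_nonempty[OF C])
    have gC: "connected (g ` C)" "g ` C \<subseteq> X" "g ` C \<noteq> {}"
      using CX g in_components_connected[OF C]
      by (auto intro!: connected_continuous_image intro: continuous_on_subset)
    then obtain D where D: "D \<in> components X" "g ` C \<subseteq> D"
      using exists_component_superset[of "g ` C" X] CX by blast
    have "compact C" by (rule compact_components[OF X C])
    then have "compact (g ` C)" using g CX by (meson compact_continuous_image continuous_on_subset)
    then have "closedin (top_of_set D) (g ` C)"
      using D by (simp add: closed_subset compact_imp_closed)
    moreover have "openin (top_of_set D) (g ` C)"
      by (rule openin_subset_trans[OF gop[OF op[OF C]] D(2) in_components_subset[OF D(1)]])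
    ultimately have "g ` C = D"
      using in_components_connected[OF D(1)] gC(3) unfolding connected_clopen by blast
    with D show ?thesis by simp
  qed
  have "inj_on ((`) g) (components X)"
  proof (rule inj_onI)
    fix C D assume "C \<in> components X" "D \<in> components X" "g ` C = g ` D"
    then show "C = D"
      using inj_on_image_eq_iff[OF g(3) in_components_subset in_components_subset] by simp
  qed
  then have "(`) g ` components X = components X"
    using finite_components_if_open[OF X op] im by (intro endo_inj_surj) auto
  then have "\<Union> ((`) g ` components X) = X" using Union_components[of X] by simp
  then show ?thesis using Union_components[of X] by (metis image_Union)
qed

lemma frontier_component_open:
  assumes M: "regular_domain M" and C: "C \<in> components (frontier M)"
  shows "openin (top_of_set (frontier M)) C"
proof (subst openin_subopen, rule ballI)
  fix x assume x: "x \<in> C"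
  then have xM: "x \<in> frontier M" using in_components_subset[OF C] by blast
  obtain U \<phi> \<psi> r a where ch: "half_space_chart M x U \<phi> \<psi> r a" "open U" "x \<in> U"
    using regular_domain_chart[OF M xM] by metis
  have "U \<inter> frontier M \<subseteq> C"
    by (rule components_maximal[OF C half_space_chart_connected(3)[OF ch(1)]]) (use x xM ch in auto)
  moreover have "openin (top_of_set (frontier M)) (U \<inter> frontier M)"
    using ch(2) by (metis inf_commute openin_open_Int)
  ultimately show "\<exists>T. openin (top_of_set (frontier M)) T \<and> x \<in> T \<and> T \<subseteq> C"
    using ch xM by blast
qed

lemma half_space_chart_frontier_homeomorphism:
  assumes C: "half_space_chart M x U \<phi> \<psi> r a"
  shows "homeomorphism (frontier M \<inter> U) ({y. a \<bullet> y = 0} \<inter> ball (\<phi> x) r) \<phi> \<psi>"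
proof (rule homeomorphism_of_subsets)
  show hom: "homeomorphism U (ball (\<phi> x) r) \<phi> \<psi>" using C by (simp add: half_space_chart_def)
  show "frontier M \<inter> U \<subseteq> U" "{y. a \<bullet> y = 0} \<inter> ball (\<phi> x) r \<subseteq> ball (\<phi> x) r" by auto
  show "\<phi> ` (frontier M \<inter> U) = {y. a \<bullet> y = 0} \<inter> ball (\<phi> x) r"
  proof
    show "\<phi> ` (frontier M \<inter> U) \<subseteq> {y. a \<bullet> y = 0} \<inter> ball (\<phi> x) r"
      using hom half_space_chart_position(2)[OF C] by (auto simp: homeomorphism_def)
    show "{y. a \<bullet> y = 0} \<inter> ball (\<phi> x) r \<subseteq> \<phi> ` (frontier M \<inter> U)"
    proof
      fix y assume y: "y \<in> {y. a \<bullet> y = 0} \<inter> ball (\<phi> x) r"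
      then have p: "\<psi> y \<in> U" "\<phi> (\<psi> y) = y" using hom by (auto simp: homeomorphism_def)
      then have "\<psi> y \<in> frontier M" using half_space_chart_position(2)[OF C p(1)] y by simp
      with p show "y \<in> \<phi> ` (frontier M \<inter> U)" by (metis IntI image_eqI)
    qed
  qed
qed

text \<open>Read in charts around \<open>x\<close> and \<open>g x\<close>, the map becomes a continuous injection between open subsets of
two hyperplanes of equal dimension, to which invariance of domain applies.\<close>

lemma frontier_self_map_open:
  fixes M :: "'a::euclidean_space set"
  assumes M: "regular_domain M"
    and g: "continuous_on (frontier M) g" "g ` frontier M \<subseteq> frontier M" "inj_on g (frontier M)"
    and T: "openin (top_of_set (frontier M)) T"
  shows "openin (top_of_set (frontier M)) (g ` T)"
proof (subst openin_subopen, rule ballI)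
  fix y assume "y \<in> g ` T"
  then obtain x where x: "x \<in> T" "y = g x" by blast
  have TM: "T \<subseteq> frontier M" using T by (rule openin_imp_subset)
  have xM: "x \<in> frontier M" and yM: "y \<in> frontier M" using x TM g(2) by auto
  obtain U \<phi> \<psi> r a where C: "half_space_chart M x U \<phi> \<psi> r a" "open U" "x \<in> U"
    using regular_domain_chart[OF M xM] by metis
  obtain U' \<phi>' \<psi>' r' a' where C': "half_space_chart M y U' \<phi>' \<psi>' r' a'" "open U'" "y \<in> U'"
    using regular_domain_chart[OF M yM] by metis
  define H where "H = {y. a \<bullet> y = 0}"
  define H' where "H' = {y. a' \<bullet> y = 0}"
  have hom: "homeomorphism (frontier M \<inter> U) (H \<inter> ball (\<phi> x) r) \<phi> \<psi>"
    unfolding H_def by (rule half_space_chart_frontier_homeomorphism[OF C(1)])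
  have hom': "homeomorphism (frontier M \<inter> U') (H' \<inter> ball (\<phi>' y) r') \<phi>' \<psi>'"
    unfolding H'_def by (rule half_space_chart_frontier_homeomorphism[OF C'(1)])
  define T0 where "T0 = T \<inter> (frontier M \<inter> U) \<inter> (frontier M \<inter> g -` U')"
  have T0: "T0 \<subseteq> frontier M \<inter> U" "T0 \<subseteq> T" "g ` T0 \<subseteq> frontier M \<inter> U'"
    using g(2) by (auto simp: T0_def)
  have "openin (top_of_set (frontier M)) T0"
    unfolding T0_def using T C(2) C'(2) g(1)
    by (intro openin_Int openin_open_Int continuous_openin_preimage_gen)
  then have "openin (top_of_set (frontier M \<inter> U)) T0"
    by (rule openin_subset_trans) (use T0 in auto)
  then have "openin (top_of_set (H \<inter> ball (\<phi> x) r)) (\<phi> ` T0)"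
    by (rule homeomorphism_imp_open_map[OF hom])
  then have W: "openin (top_of_set H) (\<phi> ` T0)"
    by (rule openin_trans) (simp add: openin_open_Int)
  have \<psi>\<phi>: "\<psi> (\<phi> z) = z" if "z \<in> T0" for z
    using that T0(1) hom by (auto simp: homeomorphism_def)
  define h where "h = \<phi>' \<circ> g \<circ> \<psi>"
  have him: "h ` \<phi> ` T0 = \<phi>' ` g ` T0"
    unfolding h_def using \<psi>\<phi> by (force simp: image_iff)
  have inj': "inj_on \<phi>' (frontier M \<inter> U')"
    using hom' unfolding homeomorphism_def by (metis inj_on_inverseI)
  have W'sub: "\<phi>' ` g ` T0 \<subseteq> H' \<inter> ball (\<phi>' y) r'"
    using homeomorphism_image1[OF hom'] image_mono[OF T0(3), of \<phi>'] by simp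
  have W': "openin (top_of_set H') (h ` \<phi> ` T0)"
  proof (rule invariance_of_domain_subspaces[OF W])
    show "subspace H" "subspace H'" unfolding H_def H'_def by (rule subspace_hyperplane)+
    have "a \<noteq> 0" "a' \<noteq> 0" using C(1) C'(1) by (auto simp: half_space_chart_def)
    then show "dim H' \<le> dim H" unfolding H_def H'_def by (simp add: dim_hyperplane)
    show "continuous_on (\<phi> ` T0) h"
      unfolding h_def
    proof (intro continuous_on_compose)
      have sub: "\<phi> ` T0 \<subseteq> H \<inter> ball (\<phi> x) r"
        using homeomorphism_image1[OF hom] image_mono[OF T0(1), of \<phi>] by simp
      have e: "\<psi> ` \<phi> ` T0 = T0" using \<psi>\<phi> by (force simp: image_iff)
      show "continuous_on (\<phi> ` T0) \<psi>"
        by (rule continuous_on_subset[OF homeomorphism_cont2[OF hom] sub])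
      show "continuous_on (\<psi> ` \<phi> ` T0) g" unfolding e
        using g(1) T0(1) by (auto intro: continuous_on_subset)
      show "continuous_on (g ` \<psi> ` \<phi> ` T0) \<phi>'" unfolding e
        by (rule continuous_on_subset[OF homeomorphism_cont1[OF hom'] T0(3)])
    qed
    show "h \<in> \<phi> ` T0 \<rightarrow> H'"
    proof -
      show ?thesis using W'sub him by blast
    qed
    have "inj_on (\<phi>' \<circ> g) T0"
      using inj_on_subset[OF inj' T0(3)] inj_on_subset[OF g(3), of T0] T0(1)
      by (intro comp_inj_on) auto
    then have "inj_on (\<lambda>z. h (\<phi> z)) T0"
      unfolding h_def using \<psi>\<phi> by (simp add: inj_on_def)
    then show "inj_on h (\<phi> ` T0)" by (auto simp: inj_on_def)
  qed
  define T1 where "T1 = (frontier M \<inter> U') \<inter> \<phi>' -` (h ` \<phi> ` T0)"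
  have "openin (top_of_set (H' \<inter> ball (\<phi>' y) r')) (h ` \<phi> ` T0)"
    by (rule openin_subset_trans[OF W'])
       (use W'sub in \<open>auto simp: him\<close>)
  then have "openin (top_of_set (frontier M \<inter> U')) T1"
    unfolding T1_def using homeomorphism_cont1[OF hom'] homeomorphism_image1[OF hom']
    by (intro continuous_openin_preimage) auto
  then have "openin (top_of_set (frontier M)) T1"
    by (rule openin_trans) (simp add: C'(2) openin_open_Int)
  moreover have "y \<in> T1"
    using x C(3) C'(3) xM yM unfolding T1_def him by (auto simp: T0_def)
  moreover have "T1 \<subseteq> g ` T"
  proof
    fix z assume z: "z \<in> T1"
    then obtain t where t: "t \<in> T0" "\<phi>' z = \<phi>' (g t)" unfolding T1_def him by auto
    then have "z = g t" using inj' z T0(3) unfolding T1_def by (auto dest: inj_onD)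
    with t T0(2) show "z \<in> g ` T" by auto
  qed
  ultimately show "\<exists>T'. openin (top_of_set (frontier M)) T' \<and> y \<in> T' \<and> T' \<subseteq> g ` T"
    by blast
qed

lemma frontier_injective_self_map_surj:
  fixes M :: "'a::euclidean_space set"
  assumes M: "regular_domain M"
    and g: "continuous_on (frontier M) g" "g ` frontier M \<subseteq> frontier M" "inj_on g (frontier M)"
  shows "g ` frontier M = frontier M"
proof (rule injective_open_self_map_surj[OF _ _ g])
  show "compact (frontier M)"
    using M by (simp add: regular_domain_def compact_frontier)
qed (use frontier_component_open[OF M] frontier_self_map_open[OF M g] in auto)

section \<open>Closed neighbourhoods and shifted normals\<close>

definition thicken :: "real \<Rightarrow> 'a::euclidean_space set \<Rightarrow> 'a set" where
  "thicken e A = (\<Union>x\<in>A. cball x e)"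

lemma compact_thicken:
  assumes "compact A"
  shows "compact (thicken e A)"
proof -
  have "thicken e A = {x + y |x y. x \<in> A \<and> y \<in> cball 0 e}"
    unfolding thicken_def
  proof safe
    fix x z assume "x \<in> A" "z \<in> cball x e"
    then show "\<exists>u v. z = u + v \<and> u \<in> A \<and> v \<in> cball 0 e"
      by (intro exI[of _ x] exI[of _ "z - x"]) (auto simp: dist_norm norm_minus_commute)
  next
    fix x y :: 'a assume "x \<in> A" "y \<in> cball 0 e"
    then show "x + y \<in> (\<Union>x\<in>A. cball x e)"
      by (intro UN_I[of x]) (auto simp: dist_norm)
  qed
  then show ?thesis using compact_sums[OF assms, of "cball 0 e"] by simp
qed

lemma thicken_mono: "A \<subseteq> B \<Longrightarrow> thicken e A \<subseteq> thicken e B"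
  by (auto simp: thicken_def)

lemma ball_subset_interior_thicken: "k \<in> A \<Longrightarrow> ball k e \<subseteq> interior (thicken e A)"
  by (rule interior_maximal) (auto simp: thicken_def dest: less_imp_le)

text \<open>A boundary point of the neighbourhood sees \<open>K\<close> at distance exactly \<open>e\<close>, and the empty ball around it
touches \<open>K\<close> at a nearest point, where it determines the normal.\<close>

lemma thicken_frontier_normal:
  assumes K: "regular_domain K" and e: "e > 0" and x: "x \<in> frontier (thicken e K)"
  shows "\<exists>n. unit_normal K (x - e *\<^sub>R n) n"
proof -
  have "compact (thicken e K)" using K by (simp add: regular_domain_def compact_thicken)
  then have "x \<in> thicken e K"
    using x frontier_subset_closed compact_imp_closed by blast
  then obtain y where y: "y \<in> K" "dist y x \<le> e" by (auto simp: thicken_def)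
  have far: "e \<le> dist k x" if "k \<in> K" for k
    using ball_subset_interior_thicken[OF that, of e] x by (force simp: frontier_def)
  have dxy: "norm (x - y) = e" using y far[OF y(1)] by (simp add: dist_norm norm_minus_commute)
  have out: "ball x e \<inter> K = {}" using far by (force simp: dist_commute)
  have "y \<in> closure (ball x e)" using y e by (simp add: dist_commute)
  then have "y \<in> closure (- K)" using closure_mono[of "ball x e" "- K"] out by blast
  then have "y \<in> frontier K" using y(1) closure_subset[of K] by (auto simp: frontier_closures)
  then obtain n where n: "unit_normal K y n" using regular_domain_normal[OF K] by blast
  have "x = y + e *\<^sub>R n" by (rule unit_normal_outer_ball[OF n out dxy e])
  then show ?thesis using n by (intro exI[of _ n]) simp
qed

text \<open>The map \<open>(y, n) \<mapsto> (y + e n, n)\<close> is a bijection of the space of all pairs, so that mapping one normal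
bundle onto the other becomes an equivalence, which restricts to parts of the boundary.\<close>

definition normal_shift :: "real \<Rightarrow> 'a::euclidean_space set \<Rightarrow> 'a set \<Rightarrow> bool" where
  "normal_shift e K M \<longleftrightarrow> (\<forall>y n. unit_normal K y n \<longleftrightarrow> unit_normal M (y + e *\<^sub>R n) n)"

text \<open>Here the two touching balls meet: the ball of radius \<open>e\<close> about a nearest point of \<open>K\<close> touches the
neighbourhood from inside, so the normals on both sides agree and the nearest point is unique.\<close>

lemma thicken_normal_backward:
  assumes K: "regular_domain K" and e: "e > 0" and N: "unit_normal (thicken e K) x n"
  shows "unit_normal K (x - e *\<^sub>R n) n"
    and "\<And>y. y \<in> K \<Longrightarrow> norm (x - y) = e \<Longrightarrow> y = x - e *\<^sub>R n"
proof -
  have b: "ball y e \<subseteq> thicken e K" if "y \<in> K" for y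
    using that by (auto simp: thicken_def)
  show *: "y = x - e *\<^sub>R n" if "y \<in> K" "norm (x - y) = e" for y
    using unit_normal_inner_ball[OF N b[OF that(1)] that(2) e] by simp
  obtain n' where n': "unit_normal K (x - e *\<^sub>R n') n'"
    using thicken_frontier_normal[OF K e unit_normal_in_frontier[OF N]] by blast
  have "x - e *\<^sub>R n' \<in> K"
    using unit_normal_in_frontier[OF n'] regular_domain_frontier_subset[OF K] by blast
  then have "x - e *\<^sub>R n' = x - e *\<^sub>R n"
    by (rule *) (use unit_normal_norm[OF n'] e in simp)
  then have "n' = n" using e by simp
  with n' show "unit_normal K (x - e *\<^sub>R n) n" by simp
qed

text \<open>Every normal of \<open>M\<close> comes from \<open>K\<close> by touching balls. For the reverse inclusion the map sending \<open>x\<close> to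
its nearest point in \<open>K\<close> must be onto the boundary of \<open>K\<close>; followed by the inverse diffeomorphism it is
an injective continuous self-map of the boundary of \<open>M\<close>.\<close>

theorem thicken_eq_imp_normal_shift:
  fixes f g :: "'a::euclidean_space \<Rightarrow> 'a"
  assumes d: "diffeo_pair f g" and M: "regular_domain M" and e: "e > 0"
    and th: "thicken e (f ` M) = M"
  shows "normal_shift e (f ` M) M"
proof -
  define K where "K = f ` M"
  have d': "diffeo_pair g f" by (rule diffeo_pair_sym[OF d])
  have K: "regular_domain K" unfolding K_def by (rule regular_domain_diffeo_image[OF d M])
  have th: "thicken e K = M" using th by (simp add: K_def)
  note touch = thicken_normal_backward[OF K e, unfolded th]
  define \<nu> where "\<nu> x = (SOME n. unit_normal M x n)" for x
  have \<nu>: "unit_normal M x (\<nu> x)" if "x \<in> frontier M" for x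
    unfolding \<nu>_def using regular_domain_normal[OF M that] by (rule someI_ex)
  define foot where "foot x = x - e *\<^sub>R \<nu> x" for x
  have footN: "unit_normal K (foot x) (\<nu> x)" if "x \<in> frontier M" for x
    unfolding foot_def by (rule touch(1)[OF \<nu>[OF that]])
  have footK: "foot x \<in> frontier K" if "x \<in> frontier M" for x
    by (rule unit_normal_in_frontier[OF footN[OF that]])
  have cK: "compact (frontier K)" and cM: "compact (frontier M)"
    using K M by (simp_all add: regular_domain_def compact_frontier)
  \<comment> \<open>The graph of the nearest point map is described by a distance, so it is closed, and its
      target is compact.\<close>
  have cont: "continuous_on (frontier M) foot"
  proof (rule continuous_from_closed_graph[OF cK])
    show "foot \<in> frontier M \<rightarrow> frontier K" using footK by blast
    have "norm (x - foot x) = e" if "x \<in> frontier M" for x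
      using unit_normal_norm[OF \<nu>[OF that]] e by (simp add: foot_def)
    moreover have "y = foot x" if "x \<in> frontier M" "y \<in> frontier K" "norm (x - y) = e" for x y
    proof -
      have "y \<in> K" using regular_domain_frontier_subset[OF K] that(2) by blast
      then show ?thesis using touch(2)[OF \<nu>[OF that(1)]] that(3) by (simp add: foot_def)
    qed
    ultimately have "(\<lambda>x. (x, foot x)) ` frontier M
        = (frontier M \<times> frontier K) \<inter> {p. norm (fst p - snd p) = e}"
      using footK by (auto simp: image_iff)
    moreover have "closed {p::'a \<times> 'a. norm (fst p - snd p) = e}"
      by (intro closed_Collect_eq continuous_intros)
    ultimately show "closed ((\<lambda>x. (x, foot x)) ` frontier M)"
      using cK cM by (simp add: closed_Int closed_Times compact_imp_closed)
  qed
  \<comment> \<open>The foot point determines the normal of K, hence the point from which it came.\<close>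
  have inj: "inj_on foot (frontier M)"
  proof (rule inj_onI)
    fix x x' assume xx: "x \<in> frontier M" "x' \<in> frontier M" "foot x = foot x'"
    then have "\<nu> x = \<nu> x'" using unit_normal_unique[OF footN[OF xx(1)]] footN[OF xx(2)] by simp
    with xx(3) show "x = x'" by (simp add: foot_def)
  qed
  have gK: "g ` frontier K = frontier M"
    unfolding diffeo_pair_frontier[OF d', symmetric] K_def
    using d by (simp add: diffeo_pair_def image_image)
  have injg: "inj g" using d by (metis diffeo_pair_def injI)
  have "(g \<circ> foot) ` frontier M = frontier M"
  proof (rule frontier_injective_self_map_surj[OF M])
    show "continuous_on (frontier M) (g \<circ> foot)"
      by (intro continuous_on_compose cont diffeo_pair_continuous[OF d'])
    show "(g \<circ> foot) ` frontier M \<subseteq> frontier M" using footK gK by auto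
    show "inj_on (g \<circ> foot) (frontier M)"
      using inj injg by (auto intro: comp_inj_on inj_on_subset)
  qed
  then have "g ` (foot ` frontier M) = g ` frontier K" by (simp add: gK image_comp)
  then have surj: "foot ` frontier M = frontier K" using injg by (simp add: inj_image_eq_iff)
  show ?thesis
    unfolding normal_shift_def K_def[symmetric]
  proof (intro allI iffI)
    fix y n assume N: "unit_normal K y n"
    then obtain x where x: "x \<in> frontier M" "y = foot x"
      using surj unit_normal_in_frontier by blast
    then have "\<nu> x = n" using unit_normal_unique[OF N] footN by blast
    with x \<nu> show "unit_normal M (y + e *\<^sub>R n) n" by (auto simp: foot_def)
  next
    fix y n assume "unit_normal M (y + e *\<^sub>R n) n"
    from touch(1)[OF this] show "unit_normal K y n" by simp
  qed
qed

text \<open>A part of the interior of \<open>M\<close> outside the neighbourhood would have a boundary point \<open>x\<close> on \<open>\<partial>M\<close>. Just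
inside \<open>M\<close> at \<open>x\<close> one is then outside the neighbourhood; but moving inward from \<open>x\<close> along the normal
means moving towards the point \<open>x - e n\<close> of \<open>K\<close>, at distance \<open>e\<close>, and so into the neighbourhood.\<close>

lemma normal_shift_imp_subset_thicken:
  assumes K: "regular_domain K" and M: "regular_domain M" and e: "e > 0" and sh: "normal_shift e K M"
  shows "M \<subseteq> thicken e K"
proof (rule ccontr)
  assume "\<not> M \<subseteq> thicken e K"
  then obtain z where z: "z \<in> M" "z \<notin> thicken e K" by blast
  define E where "E = - thicken e K"
  have cth: "closed (thicken e K)"
    using K by (simp add: regular_domain_def compact_thicken compact_imp_closed)
  have foot: "x - e *\<^sub>R n \<in> K" if "unit_normal M x n" for x n
  proof -
    have "unit_normal K (x - e *\<^sub>R n) n"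
      using sh[unfolded normal_shift_def, rule_format, of "x - e *\<^sub>R n" n] that by simp
    then show ?thesis
      using unit_normal_in_frontier regular_domain_frontier_subset[OF K] by blast
  qed
  have fM: "x \<in> thicken e K" if "x \<in> frontier M" for x
  proof -
    obtain n where n: "unit_normal M x n" using regular_domain_normal[OF M \<open>x \<in> frontier M\<close>] by blast
    have "x \<in> cball (x - e *\<^sub>R n) e" using unit_normal_norm[OF n] e by (simp add: dist_norm)
    then show ?thesis unfolding thicken_def using foot[OF n] by blast
  qed
  have fE: "frontier E \<subseteq> frontier M"
  proof
    fix x assume "x \<in> frontier E"
    then obtain n where "unit_normal K (x - e *\<^sub>R n) n"
      using thicken_frontier_normal[OF K e] by (auto simp: E_def frontier_complement)
    then have "unit_normal M x n"
      using sh[unfolded normal_shift_def, rule_format, of "x - e *\<^sub>R n" n] by simp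
    then show "x \<in> frontier M" by (rule unit_normal_in_frontier)
  qed
  \<comment> \<open>The open set V is nonempty and bounded, so it has a boundary point x, which can only lie
      on the frontier of M.\<close>
  define V where "V = E \<inter> interior M"
  have "z \<in> V"
    using z fM closure_subset[of M] by (auto simp: V_def E_def frontier_def)
  have "bounded V" using M unfolding V_def regular_domain_def
    by (meson bounded_subset compact_imp_bounded inf_le2 interior_subset order_trans)
  then have "V \<noteq> UNIV" by (metis not_bounded_UNIV)
  then obtain x where x: "x \<in> frontier V" using \<open>z \<in> V\<close> frontier_eq_empty[of V] by blast
  have oE: "open E" unfolding E_def using cth by (rule open_Compl)
  then have oV: "open V" by (simp add: V_def open_Int)
  have xV: "x \<in> closure V" "x \<notin> V" using x oV by (auto simp: frontier_def interior_open)
  have "x \<in> closure E" "x \<in> closure (interior M)"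
    using xV(1) closure_mono[of V E] closure_mono[of V "interior M"] by (auto simp: V_def)
  with oE have xM: "x \<in> frontier M"
    using xV(2) fE closure_mono[OF interior_subset, of M]
    by (auto simp: V_def frontier_def interior_open)
  obtain n where n: "unit_normal M x n" using regular_domain_normal[OF M xM] by blast
  obtain U \<phi> \<psi> r a where C: "half_space_chart M x U \<phi> \<psi> r a" "open U" "x \<in> U"
    using regular_domain_chart[OF M xM] by metis
  have "U \<inter> V \<noteq> {}" using C(2,3) xV(1) open_Int_closure_eq_empty by blast
  then have "(U \<inter> interior M) \<inter> E \<noteq> {}" by (auto simp: V_def)
  moreover have "(U \<inter> interior M) \<inter> frontier E = {}" using fE by (auto simp: frontier_def)
  ultimately have UE: "U \<inter> interior M \<subseteq> E"
    using connected_Int_frontier half_space_chart_connected(2)[OF C(1)] by blast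
  have nn: "n \<bullet> n = 1" by (rule unit_normal_self[OF n])
  have "\<forall>\<^sub>F t in at_right 0. x + t *\<^sub>R (- n) \<in> interior M"
    by (rule unit_normal_along_ray(2)[OF n]) (simp add: nn)
  moreover have "\<forall>\<^sub>F t in at_right 0. x + t *\<^sub>R (- n) \<in> U"
    by (rule topological_tendstoD[OF tendsto_ray C(2,3)])
  moreover have "\<forall>\<^sub>F t in at_right 0. x + t *\<^sub>R (- n) \<in> ball (x - e *\<^sub>R n) e"
    by (rule ray_enters_ball) (use e nn unit_normal_norm[OF n] in auto)
  ultimately have "\<forall>\<^sub>F t in at_right (0::real). False"
  proof eventually_elim
    case (elim t)
    then have "x + t *\<^sub>R (- n) \<in> E" using UE by blast
    moreover have "x + t *\<^sub>R (- n) \<in> thicken e K"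
      using elim(3) foot[OF n] ball_subset_interior_thicken interior_subset by blast
    ultimately show False by (simp add: E_def)
  qed
  then show False by simp
qed

text \<open>Filling holes of \<open>K\<close> and then thickening fills holes of \<open>M\<close>: a boundary point of the result comes from a
normal of the filled set, which is a normal of \<open>K\<close>, and its shift is a normal of \<open>M\<close>. This keeps the
iteration of the set-valued map among the fillings of \<open>M\<close>.\<close>

lemma hole_filling_thicken:
  assumes K: "regular_domain K" and e: "e > 0" and sh: "normal_shift e K M"
    and sub: "M \<subseteq> thicken e K" and K': "hole_filling K K'"
  shows "hole_filling M (thicken e K')"
  unfolding hole_filling_def
proof (intro conjI subsetI)
  show "compact (thicken e K')" using K' by (simp add: hole_filling_def compact_thicken)
  show "x \<in> thicken e K'" if "x \<in> M" for x
    using that sub thicken_mono[of K K' e] K' by (auto simp: hole_filling_def)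
  fix x assume "x \<in> frontier (thicken e K')"
  then obtain n where "unit_normal K' (x - e *\<^sub>R n) n"
    using thicken_frontier_normal[OF hole_filling_regular[OF K K'] e] by blast
  then have "unit_normal K (x - e *\<^sub>R n) n" by (simp add: hole_filling_normal_iff[OF K K'])
  then have "unit_normal M x n"
    using sh[unfolded normal_shift_def, rule_format, of "x - e *\<^sub>R n" n] by simp
  then show "x \<in> frontier M" by (rule unit_normal_in_frontier)
qed

text \<open>Away from \<open>\<partial>M\<close> each set is locally everything or nothing, on the same neighbourhoods for all of them, so
the union has no new boundary. Boundedness is where dimension at least 2 enters: the complement
of a large ball is connected, so a filling that reached it would be unbounded.\<close>

lemma hole_filling_UN:
  fixes M :: "'a::euclidean_space set"
  assumes M: "regular_domain M" and dim: "DIM('a) \<ge> 2" and A: "\<And>k::nat. hole_filling M (A k)"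
  shows "hole_filling M (\<Union>k. A k)"
proof -
  have fMM: "frontier M \<subseteq> M" by (rule regular_domain_frontier_subset[OF M])
  have split: "O' \<subseteq> A k \<or> O' \<inter> A k = {}" if "connected O'" "O' \<inter> frontier M = {}" for O' k
    using connected_Int_frontier[OF that(1), of "A k"] that(2) A[of k]
    by (auto simp: hole_filling_def)
  have front: "frontier (\<Union>k. A k) \<subseteq> frontier M"
  proof (rule subsetI, rule ccontr)
    fix x assume x: "x \<in> frontier (\<Union>k. A k)" "x \<notin> frontier M"
    then have "x \<in> - frontier M" "open (- frontier M)" by auto
    then obtain r where r: "r > 0" "ball x r \<subseteq> - frontier M" by (auto simp: open_contains_ball)
    then have "ball x r \<subseteq> A k \<or> ball x r \<inter> A k = {}" for k by (intro split) auto
    then have *: "ball x r \<subseteq> (\<Union>k. A k) \<or> ball x r \<inter> (\<Union>k. A k) = {}" by blast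
    have "ball x r \<inter> closure (\<Union>k. A k) \<noteq> {}" using x(1) r(1) by (force simp: frontier_def)
    then have "ball x r \<inter> (\<Union>k. A k) \<noteq> {}" using open_Int_closure_eq_empty[OF open_ball] by blast
    with * have "ball x r \<subseteq> interior (\<Union>k. A k)" by (intro interior_maximal) auto
    then show False using x(1) r(1) by (force simp: frontier_def)
  qed
  have sub: "M \<subseteq> (\<Union>k. A k)" using A by (auto simp: hole_filling_def)
  have "closed (\<Union>k. A k)"
    using front fMM sub frontier_subset_eq by blast
  moreover have "bounded (\<Union>k. A k)"
  proof -
    have "bounded M" using M by (simp add: regular_domain_def compact_imp_bounded)
    then obtain R where R: "M \<subseteq> cball 0 R"
      using bounded_subset_ballD ball_subset_cball by (metis order_trans)
    have "A k \<subseteq> cball 0 R" for k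
    proof (rule ccontr)
      assume "\<not> A k \<subseteq> cball 0 R"
      moreover have "connected (- cball (0::'a) R)"
        by (rule connected_complement_bounded_convex) (use dim in auto)
      ultimately have "- cball 0 R \<subseteq> A k" using split[of "- cball 0 R" k] R fMM by blast
      moreover have "bounded (A k)" using A[of k] by (simp add: hole_filling_def compact_imp_bounded)
      ultimately have "bounded (- cball (0::'a) R \<union> cball 0 R)"
        using bounded_subset bounded_Un bounded_cball by blast
      then show False by (simp add: Compl_partition2)
    qed
    then show ?thesis using bounded_subset[OF bounded_cball, of "\<Union>k. A k" 0 R] by blast
  qed
  ultimately show ?thesis using sub front by (simp add: hole_filling_def compact_eq_bounded_closed)
qed

text \<open>Induction on the number of boundary components, over all diffeomorphisms and all domains. The set \<open>A\<close> is
the union of the forward images of \<open>M\<close>, and the induction hypothesis is applied to the inverse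
diffeomorphism and the image of the filled part \<open>P\<close>.\<close>

theorem normal_shift_imp_thicken_eq:
  fixes f g :: "'a::euclidean_space \<Rightarrow> 'a"
  assumes "diffeo_pair f g" "regular_domain M" "e > 0" "DIM('a) \<ge> 2"
    and "normal_shift e (f ` M) M"
  shows "thicken e (f ` M) = M"
  using assms
proof (induction "card (components (frontier (f ` M)))" arbitrary: f g M rule: less_induct)
  case less
  note d = less.prems(1) and M = less.prems(2) and e = less.prems(3) and dim = less.prems(4)
    and sh = less.prems(5)
  have d': "diffeo_pair g f" by (rule diffeo_pair_sym[OF d])
  have gf: "g (f x) = x" for x using d by (simp add: diffeo_pair_def)
  define K where "K = f ` M"
  have K: "regular_domain K" unfolding K_def by (rule regular_domain_diffeo_image[OF d M])
  have sh: "normal_shift e K M" using sh by (simp add: K_def)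
  have MK: "M \<subseteq> thicken e K" by (rule normal_shift_imp_subset_thicken[OF K M e sh])
  show ?case
  proof (cases "M = {}")
    case True
    then show ?thesis by (simp add: thicken_def)
  next
    case False
    define F where "F X = thicken e (f ` X)" for X
    define A where "A = (\<Union>k. (F ^^ k) M)"
    have "hole_filling M ((F ^^ k) M)" for k
    proof (induction k)
      case 0
      then show ?case using M by (simp add: hole_filling_def regular_domain_def)
    next
      case (Suc k)
      then have "hole_filling K (f ` ((F ^^ k) M))"
        unfolding K_def by (rule hole_filling_diffeo_image[OF d])
      from hole_filling_thicken[OF K e sh MK this]
      have "hole_filling M (F ((F ^^ k) M))" by (simp only: F_def)
      then show ?case by simp
    qed
    then have A: "hole_filling M A" unfolding A_def by (rule hole_filling_UN[OF M dim])
    then have KA: "hole_filling K (f ` A)" unfolding K_def by (rule hole_filling_diffeo_image[OF d])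
    have RA: "regular_domain A" by (rule hole_filling_regular[OF M A])
    have FA: "thicken e (f ` A) = A"
    proof -
      have "thicken e (f ` A) = (\<Union>k. (F ^^ Suc k) M)"
        unfolding A_def by (auto simp: F_def thicken_def)
      also have "\<dots> = A"
      proof
        show "(\<Union>k. (F ^^ Suc k) M) \<subseteq> A" unfolding A_def by blast
        have "(F ^^ k) M \<subseteq> (\<Union>k. (F ^^ Suc k) M)" for k
        proof (cases k)
          case 0
          have "M \<subseteq> (F ^^ Suc 0) M" using MK by (simp add: F_def K_def)
          then show ?thesis unfolding 0 by (metis UN_I UNIV_I funpow_0 subset_eq)
        qed blast
        then show "A \<subseteq> (\<Union>k. (F ^^ Suc k) M)" unfolding A_def by blast
      qed
      finally show ?thesis .
    qed
    \<comment> \<open>A is invariant, so the normals along its boundary are matched among themselves, and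
        therefore so are the normals of M along the rest of its boundary.\<close>
    have shA: "normal_shift e (f ` A) A" by (rule thicken_eq_imp_normal_shift[OF d RA e FA])
    define P where "P = closure (A - M)"
    have fP: "f ` P = closure (f ` A - K)"
      unfolding P_def K_def diffeo_pair_closure[OF d, symmetric]
      using gf by (metis image_set_diff inj_on_inverseI)
    have gfP: "g ` f ` P = P" by (simp add: image_image gf)
    have RP: "regular_domain P" unfolding P_def by (rule filled_hole_regular[OF M A])
    have frP: "frontier P = frontier M - frontier A"
      unfolding P_def by (rule filled_hole_frontier[OF M A])
    have "thicken e (g ` f ` P) = f ` P"
    proof (rule less.hyps[OF _ d' regular_domain_diffeo_image[OF d RP] e dim])
      \<comment> \<open>The boundary of M splits into those of P and A, and the bounded nonempty set A does have
          a boundary.\<close>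
      have "closed (frontier P)" "closed (frontier A)" by simp_all
      moreover have "frontier A \<noteq> {}"
        using A False unfolding hole_filling_def frontier_eq_empty
        by (metis compact_imp_bounded not_bounded_UNIV subset_empty)
      moreover have "finite (components (frontier M))"
        using M frontier_component_open[OF M]
        by (intro finite_components_if_open) (auto simp: regular_domain_def compact_frontier)
      ultimately have "card (components (frontier P)) < card (components (frontier M))"
        by (intro card_components_clopen_part[of _ _ "frontier A"])
           (use A in \<open>auto simp: frP hole_filling_def\<close>)
      then show "card (components (frontier (g ` f ` P))) < card (components (frontier (f ` M)))"
        by (simp add: gfP diffeo_pair_frontier[OF d] card_components_diffeo_image[OF d])
      show "normal_shift e (g ` f ` P) (f ` P)"
        unfolding normal_shift_def gfP
      proof (intro allI)
        fix y n
        \<comment> \<open>The normals of P are the reversed normals of M that do not belong to A, and likewise for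
            the images; reversing n turns the shift from f ` M to M into a shift from P to f ` P.\<close>
        have 1: "unit_normal P y n \<longleftrightarrow> unit_normal M y (- n) \<and> \<not> unit_normal A y (- n)"
          unfolding P_def filled_hole_normal_iff[OF M A] hole_filling_normal_iff[OF M A] by blast
        have 2: "unit_normal (f ` P) z n \<longleftrightarrow> unit_normal K z (- n) \<and> \<not> unit_normal (f ` A) z (- n)" for z
          unfolding fP filled_hole_normal_iff[OF K KA] hole_filling_normal_iff[OF K KA] by blast
        have "unit_normal K (y + e *\<^sub>R n) (- n) \<longleftrightarrow> unit_normal M y (- n)"
          using sh[unfolded normal_shift_def, rule_format, of "y + e *\<^sub>R n" "- n"] by simp
        moreover have "unit_normal (f ` A) (y + e *\<^sub>R n) (- n) \<longleftrightarrow> unit_normal A y (- n)"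
          using shA[unfolded normal_shift_def, rule_format, of "y + e *\<^sub>R n" "- n"] by simp
        ultimately show "unit_normal P y n \<longleftrightarrow> unit_normal (f ` P) (y + e *\<^sub>R n) n"
          unfolding 1 2 by simp
      qed
    qed
    then have thP: "thicken e P = f ` P" by (simp add: gfP)
    \<comment> \<open>A point of A - M within e of some k in K has a neighbour b in the open set A - M at
        distance less than e from k, so k is interior to the neighbourhood f ` P of P. But K
        meets f ` P only in boundary points.\<close>
    have "thicken e K \<subseteq> M"
    proof (rule subsetI, rule ccontr)
      fix x assume x: "x \<in> thicken e K" "x \<notin> M"
      have "K \<subseteq> f ` A" using KA by (simp add: hole_filling_def)
      then have "x \<in> A" using x(1) FA thicken_mono by blast
      with x have xB: "x \<in> A - M" by blast
      obtain k where k: "k \<in> K" "x \<in> cball k e" using x(1) by (auto simp: thicken_def)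
      have "x \<in> closure (ball k e)" using k e by simp
      then have "(A - M) \<inter> ball k e \<noteq> {}"
        using open_Int_closure_eq_empty[OF hole_filling_diff_open[OF M A]] xB by blast
      then obtain b where b: "b \<in> A - M" "b \<in> ball k e" by blast
      have "b \<in> P" using b(1) closure_subset[of "A - M"] unfolding P_def by blast
      then have "k \<in> interior (thicken e P)"
        using ball_subset_interior_thicken[of b P e] b(2) by (metis dist_commute mem_ball subsetD)
      then have "k \<in> f ` interior P" by (simp add: thP diffeo_pair_interior[OF d])
      then obtain m where m: "m \<in> interior P" "k = f m" by blast
      have "m \<in> M" using k(1) m(2) gf unfolding K_def by (metis imageE)
      moreover have "m \<in> P" using m(1) interior_subset by blast
      ultimately have "m \<in> frontier P"
        using filled_hole_closure[OF M A] frP by (auto simp: P_def)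
      with m(1) show False by (simp add: frontier_def)
    qed
    with MK show ?thesis by (simp add: K_def)
  qed
qed

section \<open>Smooth boundaries and their normal bundles\<close>

lemma Ck_on_imp_continuous_on: "Ck_on k f S \<Longrightarrow> continuous_on S f"
proof (cases k)
  case (Suc m)
  assume "Ck_on k f S"
  with Suc have "\<forall>x\<in>S. f differentiable (at x)" by simp
  then show ?thesis
    by (intro continuous_at_imp_continuous_on) (auto intro: differentiable_imp_continuous_within)
qed simp

lemma Ck_on_imp_C1:
  assumes "r \<ge> 1" "Ck_on r f S"
  shows "\<forall>x\<in>S. f differentiable (at x)"
    and "\<forall>v. continuous_on S (\<lambda>x. frechet_derivative f (at x) v)"
proof -
  obtain m where "r = Suc m" using assms(1) by (cases r) auto
  with assms(2) show "\<forall>x\<in>S. f differentiable (at x)"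
    "\<forall>v. continuous_on S (\<lambda>x. frechet_derivative f (at x) v)"
    by (auto intro: Ck_on_imp_continuous_on)
qed

lemma Ck_diffeo_imp_diffeo_pair:
  assumes "r \<ge> 1" "Ck_diffeo r UNIV UNIV f"
  obtains g where "diffeo_pair f g"
proof -
  obtain g where g: "homeomorphism UNIV UNIV f g" "Ck_on r g UNIV" "Ck_on r f UNIV"
    using assms(2) unfolding Ck_diffeo_def by blast
  then have "diffeo_pair f g"
    using Ck_on_imp_C1(1)[OF assms(1) g(2)] Ck_on_imp_C1(1)[OF assms(1) g(3)]
    by (simp add: diffeo_pair_def homeomorphism_def)
  then show thesis by (rule that)
qed

text \<open>The gradient of a local defining function points outward: in a cone around it the linear part dominates
the remainder, so the function has a definite sign there.\<close>

lemma unit_normal_of_defining_function: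
  fixes h :: "'a::euclidean_space \<Rightarrow> real"
  assumes U: "open U" "p \<in> U" and cont: "continuous_on U h" and M: "\<And>z. z \<in> U \<Longrightarrow> z \<in> M \<longleftrightarrow> h z \<le> 0"
    and h: "h p = 0" "(h has_derivative (\<lambda>w. G \<bullet> w)) (at p)" and G: "G \<noteq> 0"
  shows "unit_normal M p (sgn G)"
  unfolding unit_normal_def
proof (intro conjI allI impI)
  show "norm (sgn G) = 1" using G by (simp add: norm_sgn)
  have neg: "z \<in> interior M" if "z \<in> U" "h z < 0" for z
  proof -
    have "U \<inter> h -` {..<0} \<subseteq> interior M"
      using M continuous_open_preimage[OF cont U(1) open_lessThan] by (intro interior_maximal) auto
    with that show ?thesis by blast
  qed
  fix c :: real assume c: "c > 0"
  have "\<forall>\<^sub>F z in at p. norm (h z - h p - G \<bullet> (z - p)) \<le> (c * norm G) * norm (z - p)"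
    using h(2) c G unfolding has_derivative_within_alt2 by simp
  moreover have "\<forall>\<^sub>F z in at p. z \<in> U" using U by (rule eventually_at_in_open')
  ultimately show "\<forall>\<^sub>F z in at p.
        (c * norm (z - p) < (z - p) \<bullet> sgn G \<longrightarrow> z \<notin> M) \<and>
        ((z - p) \<bullet> sgn G < - c * norm (z - p) \<longrightarrow> z \<in> interior M)"
  proof eventually_elim
    case (elim z)
    have G1: "G \<bullet> (z - p) = norm G * ((z - p) \<bullet> sgn G)"
      using G by (simp add: sgn_div_norm inner_commute)
    have est: "\<bar>h z - G \<bullet> (z - p)\<bar> \<le> norm G * (c * norm (z - p))"
      using elim(1) h(1) by (simp add: mult_ac)
    have "h z > 0" if "c * norm (z - p) < (z - p) \<bullet> sgn G"
    proof -
      have "norm G * (c * norm (z - p)) < G \<bullet> (z - p)"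
        unfolding G1 using mult_strict_left_mono[OF that, of "norm G"] G by simp
      then show ?thesis using est by linarith
    qed
    moreover have "h z < 0" if "(z - p) \<bullet> sgn G < - c * norm (z - p)"
    proof -
      have "G \<bullet> (z - p) < - (norm G * (c * norm (z - p)))"
        unfolding G1 using mult_strict_left_mono[OF that, of "norm G"] G by simp
      then show ?thesis using est by linarith
    qed
    ultimately show ?case using elim(2) M[of z] neg[of z] by auto
  qed
qed

lemma Ck_on_subset: "Ck_on k f S \<Longrightarrow> T \<subseteq> S \<Longrightarrow> Ck_on k f T"
proof (induction k arbitrary: f)
  case 0
  then show ?case by (auto intro: continuous_on_subset)
next
  case (Suc k)
  then have "\<forall>v. Ck_on k (\<lambda>x. frechet_derivative f (at x) v) T" by simp
  moreover have "\<forall>x\<in>T. f differentiable (at x)" using Suc.prems by auto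
  ultimately show ?case by simp
qed

text \<open>In a slice chart the hypersurface has two local sides, each of which is in \<open>M\<close> or outside \<open>M\<close>. If both
were in \<open>M\<close>, the point would be interior; if both were outside, it would not be in the closure of the
interior of \<open>M\<close>. So exactly one of them belongs to \<open>M\<close>, and after choosing the sign of the covector the
chart is a half-space chart.\<close>

lemma smooth_boundary_two_sided_chart:
  fixes M :: "(real^'n) set"
  assumes r: "r \<ge> 1" and M: "smooth_boundary r M" and p: "p \<in> frontier M"
  obtains W \<phi> \<psi> \<rho> a where "half_space_chart M p W \<phi> \<psi> \<rho> a"
    "Ck_on r \<phi> W" "Ck_on r \<psi> (ball (\<phi> p) \<rho>)"
proof -
  have MM: "M = closure (interior M)" using M by (simp add: smooth_boundary_def)
  then have fMM: "frontier M \<subseteq> M" by (metis closed_closure frontier_subset_closed)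
  obtain U V :: "(real^'n) set" and \<phi> i where U: "p \<in> U" "Ck_diffeo r U V \<phi>"
    and im: "\<phi> ` (frontier M \<inter> U) = {y \<in> V. y $ i = 0}"
  proof -
    have "embedded_hypersurface r (frontier M)" using M by (simp add: smooth_boundary_def)
    from this[unfolded embedded_hypersurface_def, rule_format, OF p] show thesis
      using that by blast
  qed
  obtain \<psi> where ck: "open U" "open V" "Ck_on r \<phi> U" "homeomorphism U V \<phi> \<psi>" "Ck_on r \<psi> V"
    using U(2) unfolding Ck_diffeo_def by blast
  have \<psi>\<phi>: "\<And>z. z \<in> U \<Longrightarrow> \<psi> (\<phi> z) = z" and \<phi>\<psi>: "\<And>y. y \<in> V \<Longrightarrow> \<phi> (\<psi> y) = y"
    and \<phi>V: "\<And>z. z \<in> U \<Longrightarrow> \<phi> z \<in> V" and \<psi>U: "\<And>y. y \<in> V \<Longrightarrow> \<psi> y \<in> U"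
    and cont: "continuous_on U \<phi>" "continuous_on V \<psi>"
    using ck(4) by (auto simp: homeomorphism_def)
  obtain \<rho> where \<rho>: "\<rho> > 0" "ball (\<phi> p) \<rho> \<subseteq> V"
    using ck(2) \<phi>V[OF U(1)] by (auto simp: open_contains_ball)
  define W where "W = U \<inter> \<phi> -` ball (\<phi> p) \<rho>"
  have W: "open W" "p \<in> W" "W \<subseteq> U"
    using U(1) \<rho>(1) continuous_open_preimage[OF cont(1) ck(1) open_ball] by (auto simp: W_def)
  have hom: "homeomorphism W (ball (\<phi> p) \<rho>) \<phi> \<psi>"
  proof (rule homeomorphism_of_subsets[OF ck(4) W(3) \<rho>(2)])
    show "\<phi> ` W = ball (\<phi> p) \<rho>"
    proof
      show "ball (\<phi> p) \<rho> \<subseteq> \<phi> ` W"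
      proof
        fix y assume y: "y \<in> ball (\<phi> p) \<rho>"
        with \<rho>(2) have "\<psi> y \<in> W" "y = \<phi> (\<psi> y)" using \<psi>U \<phi>\<psi> by (auto simp: W_def)
        then show "y \<in> \<phi> ` W" by blast
      qed
    qed (auto simp: W_def)
  qed
  have fr: "z \<in> frontier M \<longleftrightarrow> \<phi> z $ i = 0" if z: "z \<in> W" for z
  proof
    have zU: "z \<in> U" using z W by blast
    show "\<phi> z $ i = 0" if "z \<in> frontier M" using im that zU by blast
    assume "\<phi> z $ i = 0"
    then have "\<phi> z \<in> \<phi> ` (frontier M \<inter> U)" using \<phi>V[OF zU] im by blast
    then show "z \<in> frontier M" using \<psi>\<phi> zU by (metis IntE imageE)
  qed
  have conn: "connected {z \<in> W. \<phi> z \<in> H}" if "convex H" for H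
  proof -
    have "{z \<in> W. \<phi> z \<in> H} = \<psi> ` (ball (\<phi> p) \<rho> \<inter> H)"
      using hom unfolding homeomorphism_def by (auto simp: image_iff)
    moreover have "connected (\<psi> ` (ball (\<phi> p) \<rho> \<inter> H))"
      using cont(2) \<rho>(2) that
      by (intro connected_continuous_image convex_connected convex_Int)
         (auto intro: continuous_on_subset)
    ultimately show ?thesis by simp
  qed
  define H where "H s = {z \<in> W. s * (\<phi> z $ i) > 0}" for s :: real
  \<comment> \<open>Either local side of the hypersurface avoids the frontier, so it lies in M or misses M.\<close>
  have side: "H s \<subseteq> M \<or> H s \<inter> M = {}" for s
  proof -
    have eq: "H s = {z \<in> W. \<phi> z \<in> {y. axis i s \<bullet> y > 0}}"
      by (simp add: H_def inner_axis')
    have "connected (H s)"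
      unfolding eq by (rule conn[OF convex_halfspace_gt])
    moreover have "H s \<inter> frontier M = {}" using fr by (auto simp: H_def)
    ultimately show ?thesis using connected_Int_frontier by blast
  qed
  have split: "z \<in> H 1 \<or> z \<in> H (- 1) \<or> z \<in> frontier M" if "z \<in> W" for z
    using fr[OF that] that by (auto simp: H_def linorder_neq_iff)
  have not_in: "\<not> (H 1 \<subseteq> M \<and> H (- 1) \<subseteq> M)"
  proof
    assume "H 1 \<subseteq> M \<and> H (- 1) \<subseteq> M"
    then have "W \<subseteq> M" using split fMM by blast
    then have "p \<in> interior M" using W interior_maximal by blast
    with p show False by (simp add: frontier_def)
  qed
  have not_out: "\<not> (H 1 \<inter> M = {} \<and> H (- 1) \<inter> M = {})"
  proof
    assume "H 1 \<inter> M = {} \<and> H (- 1) \<inter> M = {}"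
    then have "W \<inter> M \<subseteq> frontier M" using split by blast
    then have "W \<inter> interior M = {}" using interior_subset[of M] by (auto simp: frontier_def)
    then have "W \<inter> closure (interior M) = {}" using open_Int_closure_eq_empty[OF W(1)] by blast
    then show False using p fMM W(2) MM by blast
  qed
  obtain s where s: "s = 1 \<or> s = - 1" and out: "H s \<inter> M = {}" and ins: "H (- s) \<subseteq> M"
  proof (cases "H 1 \<inter> M = {}")
    case True
    then show thesis using that[of 1] side[of "- 1"] not_out by blast
  next
    case False
    have "- (- 1) = (1::real)" by simp
    with False show thesis using that[of "- 1"] side[of 1] side[of "- 1"] not_in by metis
  qed
  have "z \<in> M \<longleftrightarrow> axis i s \<bullet> \<phi> z \<le> 0" if z: "z \<in> W" for z
  proof
    have ax: "axis i s \<bullet> \<phi> z = s * (\<phi> z $ i)" by (simp add: inner_axis')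
    show "axis i s \<bullet> \<phi> z \<le> 0" if "z \<in> M"
    proof -
      have "z \<notin> H s" using out that by blast
      then show ?thesis using z by (simp add: H_def ax)
    qed
    show "z \<in> M" if "axis i s \<bullet> \<phi> z \<le> 0"
    proof -
      have "z \<notin> H s" using that by (simp add: H_def ax)
      then have "z \<in> H (- s) \<or> z \<in> frontier M" using split[OF z] s by auto
      then show ?thesis using ins fMM by blast
    qed
  qed
  moreover have "axis i s \<bullet> \<phi> p = 0" using fr[OF W(2)] p by (simp add: inner_axis')
  moreover have "axis i s \<noteq> 0" using s by (auto simp: axis_eq_0_iff)
  ultimately have "half_space_chart M p W \<phi> \<psi> \<rho> (axis i s)"
    using W hom \<rho>(1) by (simp add: half_space_chart_def)
  then show thesis
    by (rule that) (use Ck_on_subset[OF ck(3) W(3)] Ck_on_subset[OF ck(5) \<rho>(2)] in auto)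
qed

text \<open>The chart supplies both a defining function, its composition with the covector, and tangent vectors, the
velocities of the curves that are straight lines in the hyperplane. The latter exhaust the orthogonal
complement of the normal, and this is what ties normals defined by orthogonality to \<open>unit_normal\<close>.\<close>

lemma smooth_boundary_normal:
  fixes M :: "(real^'n) set"
  assumes r: "r \<ge> 1" and M: "smooth_boundary r M" and p: "p \<in> frontier M"
  obtains n where "unit_normal M p n" "\<And>u. u \<bullet> n = 0 \<Longrightarrow> u \<in> tangent_vectors (frontier M) p"
proof -
  obtain W \<phi> \<psi> \<rho> a where C: "half_space_chart M p W \<phi> \<psi> \<rho> a"
    and ck: "Ck_on r \<phi> W" "Ck_on r \<psi> (ball (\<phi> p) \<rho>)"
    using smooth_boundary_two_sided_chart[OF r M p] by metis
  have W: "open W" "p \<in> W" and \<rho>: "\<rho> > 0" and hom: "homeomorphism W (ball (\<phi> p) \<rho>) \<phi> \<psi>"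
    and a: "a \<noteq> 0" "a \<bullet> \<phi> p = 0" and MW: "\<And>z. z \<in> W \<Longrightarrow> z \<in> M \<longleftrightarrow> a \<bullet> \<phi> z \<le> 0"
    using C by (auto simp: half_space_chart_def)
  define B where "B = ball (\<phi> p) \<rho>"
  have B: "open B" "\<phi> p \<in> B" using \<rho> by (simp_all add: B_def)
  have \<psi>p: "\<psi> (\<phi> p) = p" using hom W(2) by (auto simp: homeomorphism_def)
  have D\<psi>: "(\<psi> has_derivative frechet_derivative \<psi> (at y)) (at y)" if "y \<in> B" for y
    using Ck_on_imp_C1(1)[OF r ck(2)] that unfolding B_def frechet_derivative_works by blast
  define \<phi>' where "\<phi>' = frechet_derivative \<phi> (at p)"
  define \<psi>' where "\<psi>' = frechet_derivative \<psi> (at (\<phi> p))"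
  have \<phi>': "(\<phi> has_derivative \<phi>') (at p)"
    using Ck_on_imp_C1(1)[OF r ck(1)] W(2) unfolding \<phi>'_def frechet_derivative_works by blast
  have \<psi>': "(\<psi> has_derivative \<psi>') (at (\<phi> p))" using D\<psi>[OF B(2)] by (simp add: \<psi>'_def)
  have lin: "linear \<phi>'" using \<phi>' by (rule has_derivative_linear)
  have \<phi>'\<psi>': "\<phi>' (\<psi>' w) = w" for w
  proof -
    have "(\<phi> \<circ> \<psi> has_derivative \<phi>' \<circ> \<psi>') (at (\<phi> p))"
      using \<psi>' \<phi>' by (intro diff_chain_at) (simp_all add: \<psi>p)
    moreover have "((\<lambda>y. y) has_derivative (\<lambda>w. w)) (at (\<phi> p))" by (rule has_derivative_ident)
    then have "(\<phi> \<circ> \<psi> has_derivative (\<lambda>w. w)) (at (\<phi> p))"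
      by (rule has_derivative_transform_within_open[OF _ B])
         (use hom in \<open>auto simp: homeomorphism_def B_def\<close>)
    ultimately have "\<phi>' \<circ> \<psi>' = (\<lambda>w. w)" by (rule has_derivative_unique)
    then show ?thesis by (simp add: fun_eq_iff)
  qed
  have \<psi>'\<phi>': "\<psi>' (\<phi>' w) = w" for w
  proof -
    have "(\<psi> \<circ> \<phi> has_derivative \<psi>' \<circ> \<phi>') (at p)" using \<psi>' \<phi>' by (intro diff_chain_at)
    moreover have "((\<lambda>y. y) has_derivative (\<lambda>w. w)) (at p)" by (rule has_derivative_ident)
    then have "(\<psi> \<circ> \<phi> has_derivative (\<lambda>w. w)) (at p)"
      by (rule has_derivative_transform_within_open[OF _ W])
         (use hom in \<open>auto simp: homeomorphism_def\<close>)
    ultimately have "\<psi>' \<circ> \<phi>' = (\<lambda>w. w)" by (rule has_derivative_unique)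
    then show ?thesis by (simp add: fun_eq_iff)
  qed
  define G where "G = adjoint \<phi>' a"
  have G: "G \<bullet> w = a \<bullet> \<phi>' w" for w
    unfolding G_def using adjoint_works[OF lin, of w a] by (simp add: inner_commute)
  have "G \<noteq> 0"
  proof
    assume "G = 0"
    then have "a \<bullet> \<phi>' (\<psi>' a) = 0" using G[of "\<psi>' a"] by simp
    with a(1) show False by (simp add: \<phi>'\<psi>')
  qed
  show thesis
  proof (rule that)
    have "((\<lambda>z. a \<bullet> \<phi> z) has_derivative (\<lambda>w. G \<bullet> w)) (at p)"
      unfolding G by (rule has_derivative_inner_right[OF \<phi>'])
    moreover have "continuous_on W (\<lambda>z. a \<bullet> \<phi> z)"
      using hom by (intro continuous_intros) (auto simp: homeomorphism_def)
    ultimately show "unit_normal M p (sgn G)"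
      using unit_normal_of_defining_function[OF W _ MW a(2) _ \<open>G \<noteq> 0\<close>] by blast
    fix u assume "u \<bullet> sgn G = 0"
    then have "G \<bullet> u = 0" using \<open>G \<noteq> 0\<close> by (simp add: sgn_div_norm inner_commute)
    then have au: "a \<bullet> \<phi>' u = 0" by (simp add: G)
    define w where "w = \<phi>' u"
    define \<gamma> where "\<gamma> t = \<psi> (\<phi> p + t *\<^sub>R w)" for t
    \<comment> \<open>For parameters below this bound the line stays in the ball of the chart; the added 1
        covers w = 0.\<close>
    define \<delta> where "\<delta> = \<rho> / (norm w + 1)"
    have \<delta>: "\<delta> > 0" using \<rho> by (simp add: \<delta>_def add_nonneg_pos)
    have inB: "\<phi> p + t *\<^sub>R w \<in> B" if "t \<in> {- \<delta><..<\<delta>}" for t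
    proof -
      have "\<bar>t\<bar> < \<delta>" using that by auto
      then have "\<bar>t\<bar> * (norm w + 1) < \<rho>"
        unfolding \<delta>_def by (simp add: pos_less_divide_eq add_nonneg_pos)
      moreover have "\<bar>t\<bar> * norm w \<le> \<bar>t\<bar> * (norm w + 1)" by (simp add: mult_left_mono)
      ultimately show ?thesis by (simp add: B_def dist_norm)
    qed
    have D\<gamma>: "(\<gamma> has_derivative (\<lambda>s. frechet_derivative \<psi> (at (\<phi> p + t *\<^sub>R w)) (s *\<^sub>R w))) (at t)"
      if "t \<in> {- \<delta><..<\<delta>}" for t
    proof -
      have "((\<lambda>t. \<phi> p + t *\<^sub>R w) has_derivative (\<lambda>s. s *\<^sub>R w)) (at t)"
        by (auto intro!: derivative_eq_intros)
      from diff_chain_at[OF this D\<psi>[OF inB[OF that]]] show ?thesis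
        unfolding \<gamma>_def by (simp add: comp_def)
    qed
    have "Ck_on 1 \<gamma> {- \<delta><..<\<delta>}"
    proof -
      have "\<gamma> differentiable (at t)" if "t \<in> {- \<delta><..<\<delta>}" for t
        using D\<gamma>[OF that] by (auto simp: differentiable_def)
      moreover have "continuous_on {- \<delta><..<\<delta>} (\<lambda>t. frechet_derivative \<gamma> (at t) v)" for v
      proof -
        have "continuous_on B (\<lambda>y. frechet_derivative \<psi> (at y) (v *\<^sub>R w))"
          using Ck_on_imp_C1(2)[OF r ck(2)] by (simp add: B_def)
        then have "continuous_on {- \<delta><..<\<delta>}
            (\<lambda>t. frechet_derivative \<psi> (at (\<phi> p + t *\<^sub>R w)) (v *\<^sub>R w))"
          by (rule continuous_on_compose2) (use inB in \<open>auto intro!: continuous_intros\<close>)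
        then show ?thesis
        proof (rule continuous_on_eq)
          fix t assume "t \<in> {- \<delta><..<\<delta>}"
          from frechet_derivative_at[OF D\<gamma>[OF this]]
          show "frechet_derivative \<psi> (at (\<phi> p + t *\<^sub>R w)) (v *\<^sub>R w) = frechet_derivative \<gamma> (at t) v"
            by (rule fun_cong)
        qed
      qed
      ultimately show ?thesis by simp
    qed
    moreover have "\<gamma> t \<in> frontier M" if t: "t \<in> {- \<delta><..<\<delta>}" for t
    proof -
      have "\<gamma> t \<in> W" "\<phi> (\<gamma> t) = \<phi> p + t *\<^sub>R w"
        using hom inB[OF t] by (auto simp: homeomorphism_def B_def \<gamma>_def)
      then show ?thesis
        using half_space_chart_position(2)[OF C] a(2) au by (simp add: inner_add w_def)
    qed
    moreover have "\<gamma> 0 = p" by (simp add: \<gamma>_def \<psi>p)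
    moreover have "(\<gamma> has_vector_derivative u) (at 0)"
    proof -
      have "(\<lambda>s. \<psi>' (s *\<^sub>R w)) = (\<lambda>s. s *\<^sub>R u)"
        using has_derivative_linear[OF \<psi>'] by (simp add: linear_cmul w_def \<psi>'\<phi>')
      then show ?thesis using D\<gamma>[of 0] \<delta> by (simp add: has_vector_derivative_def \<psi>'_def)
    qed
    ultimately show "u \<in> tangent_vectors (frontier M) p"
      unfolding tangent_vectors_def using \<delta> by blast
  qed
qed

lemma smooth_boundary_imp_regular_domain:
  assumes "r \<ge> 1" "compact M" "smooth_boundary r M"
  shows "regular_domain M"
  unfolding regular_domain_def
proof (intro conjI ballI)
  fix x assume x: "x \<in> frontier M"
  show "\<exists>n. unit_normal M x n" using smooth_boundary_normal[OF assms(1,3) x] by metis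
  show "\<exists>U \<phi> \<psi> r a. half_space_chart M x U \<phi> \<psi> r a"
    using smooth_boundary_two_sided_chart[OF assms(1,3) x] by metis
qed fact

lemma tangent_orthogonal_unit_normal:
  assumes M: "closed M" and N: "unit_normal M p n" and v: "v \<in> tangent_vectors (frontier M) p"
  shows "n \<bullet> v = 0"
proof -
  obtain \<gamma> \<delta> where \<gamma>: "\<delta> > 0" "\<gamma> ` {-\<delta><..<\<delta>} \<subseteq> frontier M" "\<gamma> 0 = p"
    "(\<gamma> has_vector_derivative v) (at 0)"
    using v unfolding tangent_vectors_def by blast
  have d: "(\<gamma> has_vector_derivative v) (at_right 0)"
    using \<gamma>(4) has_vector_derivative_at_within by blast
  have ev: "\<forall>\<^sub>F t in at_right 0. \<gamma> t \<in> frontier M"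
    unfolding eventually_at_right_field using \<gamma>(1,2) by (intro exI[of _ \<delta>]) auto
  have False if "v \<bullet> n > 0"
  proof -
    have "\<forall>\<^sub>F t in at_right (0::real). False"
      using unit_normal_along_curve(1)[OF N d \<gamma>(3) that] ev
      by eventually_elim (use frontier_subset_closed[OF M] in blast)
    then show False by simp
  qed
  moreover have False if "v \<bullet> n < 0"
  proof -
    have "\<forall>\<^sub>F t in at_right (0::real). False"
      using unit_normal_along_curve(2)[OF N d \<gamma>(3) that] ev
      by eventually_elim (simp add: frontier_def)
    then show False by simp
  qed
  ultimately show ?thesis by (metis inner_commute linorder_neqE_linordered_idom)
qed

text \<open>Orthogonality to the tangent vectors leaves the two vectors \<open>\<plusminus> m\<close>, with \<open>m\<close> the first-order normal, and
the requirement that the ray leaves \<open>M\<close> selects \<open>m\<close>.\<close>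

lemma outer_unit_normal_bundle_eq:
  fixes M :: "(real^'n) set"
  assumes r: "r \<ge> 1" and cM: "compact M" and M: "smooth_boundary r M"
  shows "outer_unit_normal_bundle M = {(x, n). unit_normal M x n}"
proof (intro set_eqI, clarify)
  fix x n
  have exit: "(\<exists>\<delta>>0. \<forall>t. 0 < t \<and> t < \<delta> \<longrightarrow> x + t *\<^sub>R n \<notin> M) \<longleftrightarrow> (\<forall>\<^sub>F t in at_right 0. x + t *\<^sub>R n \<notin> M)"
    unfolding eventually_at_right_field by (simp add: imp_conjL)
  show "(x, n) \<in> outer_unit_normal_bundle M \<longleftrightarrow> (x, n) \<in> {(x, n). unit_normal M x n}"
  proof
    assume "(x, n) \<in> {(x, n). unit_normal M x n}"
    then have N: "unit_normal M x n" by simp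
    have "\<forall>\<^sub>F t in at_right 0. x + t *\<^sub>R n \<notin> M"
      by (rule unit_normal_along_ray(1)[OF N]) (simp add: unit_normal_self[OF N])
    then show "(x, n) \<in> outer_unit_normal_bundle M"
      using unit_normal_norm[OF N] unit_normal_in_frontier[OF N]
        tangent_orthogonal_unit_normal[OF compact_imp_closed[OF cM] N]
      by (simp add: outer_unit_normal_bundle_def unit_tangent_bundle_def exit)
  next
    assume A: "(x, n) \<in> outer_unit_normal_bundle M"
    then have n1: "norm n = 1" and x: "x \<in> frontier M"
      and tan: "\<And>v. v \<in> tangent_vectors (frontier M) x \<Longrightarrow> n \<bullet> v = 0"
      and out: "\<forall>\<^sub>F t in at_right 0. x + t *\<^sub>R n \<notin> M"
      by (auto simp: outer_unit_normal_bundle_def unit_tangent_bundle_def exit)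
    obtain m where m: "unit_normal M x m" "\<And>u. u \<bullet> m = 0 \<Longrightarrow> u \<in> tangent_vectors (frontier M) x"
      using smooth_boundary_normal[OF r M x] by metis
    note mm = unit_normal_self[OF m(1)]
    define u where "u = n - (n \<bullet> m) *\<^sub>R m"
    have um: "u \<bullet> m = 0" by (simp add: u_def inner_diff mm)
    have "n \<bullet> u = 0" by (rule tan[OF m(2)[OF um]])
    then have "u \<bullet> u = 0" using um by (simp add: u_def inner_diff inner_commute)
    then have nm: "n = (n \<bullet> m) *\<^sub>R m" by (simp add: u_def)
    have "\<not> n \<bullet> m < 0"
    proof
      assume "n \<bullet> m < 0"
      from unit_normal_along_ray(2)[OF m(1) this] out
      have "\<forall>\<^sub>F t in at_right (0::real). False"
        by eventually_elim (use interior_subset in blast)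
      then show False by simp
    qed
    moreover have "\<bar>n \<bullet> m\<bar> = 1"
      using arg_cong[OF nm, of norm] n1 unit_normal_norm[OF m(1)] by simp
    ultimately have "n \<bullet> m = 1" by linarith
    then have "n = m" using nm by simp
    with m show "(x, n) \<in> {(x, n). unit_normal M x n}" by simp
  qed
qed

section \<open>The boundary map\<close>

lemma boundary_map_unit_normal:
  fixes f :: "real^'n \<Rightarrow> real^'n"
  assumes d: "diffeo_pair f g" and N: "unit_normal M x n"
  shows "\<exists>m. unit_normal (f ` M) (f x) m \<and> boundary_map f e (x, n) = (f x + e *\<^sub>R m, m)"
proof -
  define J where "J = jacobian f (at x)"
  have fJ: "(f has_derivative (\<lambda>h. J *v h)) (at x)"
    using d unfolding diffeo_pair_def J_def by (simp add: jacobian_works)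
  define J' where "J' = jacobian g (at (f x))"
  have gJ: "(g has_derivative (\<lambda>h. J' *v h)) (at (f x))"
    using d unfolding diffeo_pair_def J'_def by (simp add: jacobian_works)
  have "((\<lambda>y. y) has_derivative (\<lambda>h. J' *v (J *v h))) (at x)"
    using diff_chain_at[OF fJ gJ] d by (simp add: comp_def diffeo_pair_def)
  from has_derivative_unique[OF this has_derivative_ident]
  have "J' ** J = mat 1"
    by (simp add: matrix_eq matrix_vector_mul_assoc[symmetric] fun_eq_iff)
  then have "transpose J ** transpose J' = mat 1" by (metis matrix_transpose_mul transpose_mat)
  then have "invertible (transpose J)"
    by (auto simp: invertible_def matrix_left_right_inverse)
  then have inv: "transpose J ** matrix_inv (transpose J) = mat 1"
    unfolding invertible_def matrix_inv_def by (rule someI2_ex) simp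
  define w where "w = matrix_inv (transpose J) *v n"
  have "transpose J *v w = n"
    unfolding w_def by (simp add: matrix_vector_mul_assoc inv)
  then have "w \<bullet> (J *v u) = n \<bullet> u" for u
    by (metis dot_lmul_matrix transpose_matrix_vector)
  from unit_normal_diffeo_image[OF d N fJ this]
  have "unit_normal (f ` M) (f x) (w /\<^sub>R norm w)" by (simp add: sgn_div_norm)
  then show ?thesis
    by (intro exI[of _ "w /\<^sub>R norm w"]) (simp add: boundary_map_def Let_def w_def J_def)
qed

lemma boundary_map_invariant_iff:
  fixes f :: "real^'n \<Rightarrow> real^'n"
  assumes d: "diffeo_pair f g" and M: "regular_domain M"
  defines "N \<equiv> {(x, n). unit_normal M x n}"
  shows "boundary_map f e ` N = N \<longleftrightarrow> normal_shift e (f ` M) M"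
proof -
  have "boundary_map f e ` N = (\<lambda>(y, m). (y + e *\<^sub>R m, m)) ` {(y, m). unit_normal (f ` M) y m}"
  proof (intro subset_antisym subsetI)
    fix q assume "q \<in> boundary_map f e ` N"
    then obtain x n where "unit_normal M x n" "q = boundary_map f e (x, n)" by (auto simp: N_def)
    then show "q \<in> (\<lambda>(y, m). (y + e *\<^sub>R m, m)) ` {(y, m). unit_normal (f ` M) y m}"
      using boundary_map_unit_normal[OF d, of M x n e] by force
  next
    fix q assume "q \<in> (\<lambda>(y, m). (y + e *\<^sub>R m, m)) ` {(y, m). unit_normal (f ` M) y m}"
    then obtain y m where q: "unit_normal (f ` M) y m" "q = (y + e *\<^sub>R m, m)" by auto
    then obtain x where x: "x \<in> frontier M" "y = f x"
      using unit_normal_in_frontier diffeo_pair_frontier[OF d, of M] by blast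
    obtain n where n: "unit_normal M x n" using regular_domain_normal[OF M x(1)] by blast
    obtain m' where m': "unit_normal (f ` M) (f x) m'" "boundary_map f e (x, n) = (f x + e *\<^sub>R m', m')"
      using boundary_map_unit_normal[OF d n] by blast
    have "m' = m" using unit_normal_unique m'(1) q(1) x(2) by blast
    then have "q = boundary_map f e (x, n)" using m'(2) q(2) x(2) by simp
    then show "q \<in> boundary_map f e ` N" using n by (auto simp: N_def)
  qed
  moreover have "(\<lambda>(y, m). (y + e *\<^sub>R m, m)) ` {(y, m). unit_normal (f ` M) y m}
      = {(x, m). unit_normal (f ` M) (x - e *\<^sub>R m) m}"
    by (force simp: image_iff)
  ultimately have "boundary_map f e ` N = N \<longleftrightarrow>
      (\<forall>x m. unit_normal (f ` M) (x - e *\<^sub>R m) m \<longleftrightarrow> unit_normal M x m)"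
    by (auto simp: N_def set_eq_iff)
  also have "\<dots> \<longleftrightarrow> normal_shift e (f ` M) M"
    unfolding normal_shift_def by (metis add_diff_cancel diff_add_cancel)
  finally show ?thesis .
qed

section \<open>Invariance of the set and of its normal bundle\<close>

theorem theorem1:
  fixes f :: "real^'n \<Rightarrow> real^'n" and M :: "(real^'n) set" and \<epsilon> :: real and r :: nat
  assumes "CARD('n) \<ge> 2" and "r \<ge> 1" and "\<epsilon> > 0"
    and "Ck_diffeo r UNIV UNIV f"
    and "compact M" and "smooth_boundary r M"
  shows "F_image f \<epsilon> M = M \<longleftrightarrow>
    boundary_map f \<epsilon> ` outer_unit_normal_bundle M = outer_unit_normal_bundle M"
proof -
  obtain g where d: "diffeo_pair f g"
    using Ck_diffeo_imp_diffeo_pair[OF assms(2,4)] .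
  have M: "regular_domain M"
    using assms(2,5,6) by (rule smooth_boundary_imp_regular_domain)
  have "F_image f \<epsilon> M = thicken \<epsilon> (f ` M)"
    by (simp add: F_image_def F_map_def thicken_def)
  moreover have "thicken \<epsilon> (f ` M) = M \<longleftrightarrow> normal_shift \<epsilon> (f ` M) M"
    using thicken_eq_imp_normal_shift[OF d M assms(3)]
      normal_shift_imp_thicken_eq[OF d M assms(3)] assms(1) by auto
  ultimately show ?thesis
    unfolding outer_unit_normal_bundle_eq[OF assms(2,5,6)] boundary_map_invariant_iff[OF d M] by simp
qed

end
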